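(* Let $p\in[0,1]$, $y:=1-p/2$ and $q:=1-p$. The quantities $M_p(n,k,m,r)$, for integers with $r\ge 0$, $k,m\ge1$ and $k+m>n-r\ge k,m$, satisfy the following. (i) For $r>0$, \[ M_p(n,k,m,r)=M_p(n-r,k,m,0)\,q^{r(r+k+m-n)}\,y^{r(2n-2r-k-m)}. \] (ii) For $n>k$ and $n\ge m$, \[ M_p(n,k,m,0)=\sum_{j=1}^{n-k}\binom{n-k-1}{j-1}M_p(n-j,k,m-j,0)\,d_p(j,j)\,y^{j(n-m)}\bigl(y^{m+k-n}-y^{n-k-j}q^{m+k-n}\bigr)q^{(j-1)(m+k-n)}y^{(j-1)(n-k-j)}. \] (iii) $M_p(n,k,m,r)=M_p(n,m,k,r)$. (iv) \[ M_p(n,n,n,0)=1-\sum_{j=1}^{n-1}\binom{n-1}{j-1}\sum_{k=j}^{n}\binom{n-j}{k-j}\sum_{m=j}^{n-k+j}\binom{n-k}{m-j}M_p(n,k,m,n-m-k+j). \] (v) For $n\ge 3$, \[ g_n(p)=\sum_{j=1}^{n-2}\sum_{k=j}^{n-1}\sum_{m=j}^{n-k+j}\binom{n-1}{j-1,\;m-j,\;k-j,\;n-k-m+j}\,\frac{(n-k-1)(n-m-1)+n-j-1}{(n-1)(n-2)}\,M_p(n,k,m,n-m-k+j). \]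
   Context: $G(n,p)$ is the random graph on the vertex set $[n]=\{1,\dots,n\}$ in which each possible edge is present independently with probability $p$. $\vec G(n,p)$ is obtained from it by giving each present edge one of its two orientations with probability $1/2$ each, independently of everything else. $\{u\not\to v\}$ is the event that there is no directed path from $u$ to $v$. For a vertex $v$, the out-cluster $\overrightarrow{C}_v$ is the random set of all vertices $u$ for which there is a directed path from $v$ to $u$, and the in-cluster $\overleftarrow{C}_v$ is the random set of all vertices $u$ for which there is a directed path from $u$ to $v$; by convention $v\in\overrightarrow{C}_v\cap\overleftarrow{C}_v$. For $n\ge1$ and $s\in X\subseteq[n]$ with $|X|=k$, define $d_p(n,k):=\mathbb P_{\vec G(n,p)}(\overrightarrow{C}_s=X)$. For $n\ge1$, $s\in X\subseteq[n]$, $s\in Y\subseteq[n]$ with $|X|=k$, $|Y|=m$ and $|[n]\setminus(Y\cup X)|=r$, define $M_p(n,k,m,r):=\mathbb P_{\vec G(n,p)}(\overrightarrow{C}_s=X,\ \overleftarrow{C}_s=Y)$; in particular $M_p(1,1,1,0)=1$. By symmetry these depend only on the displayed parameters. For distinct vertices $a,s,b$, $g_n(p):=\mathbb P_{\vec G(n,p)}(a\not\to s,\ s\not\to b)$. $\binom{N}{i_1,i_2,i_3,i_4}=\frac{N!}{i_1!\,i_2!\,i_3!\,i_4!}$ denotes a multinomial coefficient, and $0^0=1$. *)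

theory Defs
  imports "HOL-Probability.Probability" "HOL-Combinatorics.Permutations"
begin

definition all_edges :: "nat \<Rightarrow> nat set set" where
  "all_edges n = {e. e \<subseteq> {1..n} \<and> card e = 2}"

definition gnp :: "nat \<Rightarrow> real \<Rightarrow> nat set set pmf" where
  "gnp n p = map_pmf (\<lambda>f. {e \<in> all_edges n. f e})
     (Pi_pmf (all_edges n) False (\<lambda>_. bernoulli_pmf p))"

definition orientations :: "nat set \<Rightarrow> (nat \<times> nat) set" where
  "orientations e = {(u, v). e = {u, v}}"

text \<open>A digraph on \<open>{1..n}\<close> is represented by its set of arcs. The value \<open>(0, 0)\<close> is only the
  dummy value that \<^const>\<open>Pi_pmf\<close> requires outside the index set; it never becomes an arc.\<close>

definition random_orientation :: "nat set set \<Rightarrow> nat rel pmf" where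
  "random_orientation E =
     map_pmf (\<lambda>f. f ` E) (Pi_pmf E (0, 0) (\<lambda>e. pmf_of_set (orientations e)))"

definition dgnp :: "nat \<Rightarrow> real \<Rightarrow> nat rel pmf" where
  "dgnp n p = bind_pmf (gnp n p) random_orientation"

definition out_cluster :: "nat rel \<Rightarrow> nat \<Rightarrow> nat set" where
  "out_cluster D v = {u. (v, u) \<in> D\<^sup>*}"

definition in_cluster :: "nat rel \<Rightarrow> nat \<Rightarrow> nat set" where
  "in_cluster D v = {u. (u, v) \<in> D\<^sup>*}"

text \<open>The quantities \<open>d\<^sub>p(n,k)\<close>, \<open>M\<^sub>p(n,k,m,r)\<close> and \<open>g\<^sub>n(p)\<close> are the common values, over all admissible
  choices of vertices and vertex sets, of the respective probabilities. That these values do not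
  depend on the choice is proved below (\<open>d_prob_eq\<close>, \<open>M_prob_eq\<close>, \<open>g_prob_eq\<close>). If there is no
  admissible choice, the definitions say nothing.\<close>

definition d_prob :: "real \<Rightarrow> nat \<Rightarrow> nat \<Rightarrow> real" where
  "d_prob p n k = (THE x. \<forall>s X. s \<in> X \<and> X \<subseteq> {1..n} \<and> card X = k \<longrightarrow>
     x = measure_pmf.prob (dgnp n p) {D. out_cluster D s = X})"

definition M_prob :: "real \<Rightarrow> nat \<Rightarrow> nat \<Rightarrow> nat \<Rightarrow> nat \<Rightarrow> real" where
  "M_prob p n k m r = (THE x. \<forall>s X Y.
     s \<in> X \<and> X \<subseteq> {1..n} \<and> s \<in> Y \<and> Y \<subseteq> {1..n} \<and>
     card X = k \<and> card Y = m \<and> card ({1..n} - (Y \<union> X)) = r \<longrightarrow>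
     x = measure_pmf.prob (dgnp n p) {D. out_cluster D s = X \<and> in_cluster D s = Y})"

definition g_prob :: "nat \<Rightarrow> real \<Rightarrow> real" where
  "g_prob n p = (THE x. \<forall>a s b.
     a \<in> {1..n} \<and> s \<in> {1..n} \<and> b \<in> {1..n} \<and> a \<noteq> s \<and> s \<noteq> b \<and> a \<noteq> b \<longrightarrow>
     x = measure_pmf.prob (dgnp n p) {D. (a, s) \<notin> D\<^sup>* \<and> (s, b) \<notin> D\<^sup>*})"

definition multinomial4 :: "nat \<Rightarrow> nat \<Rightarrow> nat \<Rightarrow> nat \<Rightarrow> nat \<Rightarrow> real" where
  "multinomial4 N i j k l = fact N / (fact i * fact j * fact k * fact l)"


section \<open>Invariance under relabelling of the vertices\<close>

lemma finite_all_edges [simp]: "finite (all_edges n)"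
  by (rule finite_subset[of _ "Pow {1..n}"]) (auto simp: all_edges_def)

lemma card_2_orientations:
  assumes "card e = 2"
  shows "finite (orientations e)" "orientations e \<noteq> {}"
proof -
  obtain a b where "e = {a, b}" using assms by (auto simp: card_2_iff)
  then have "orientations e = {(a, b), (b, a)}"
    by (auto simp: orientations_def doubleton_eq_iff)
  then show "finite (orientations e)" "orientations e \<noteq> {}" by auto
qed

lemma Pi_pmf_reindex:
  fixes h :: "'a \<Rightarrow> 'a" and F :: "'a \<Rightarrow> 'b pmf"
  assumes "finite A" "bij h"
  shows "map_pmf (\<lambda>g. g \<circ> h) (Pi_pmf (h ` A) d F) = Pi_pmf A d (\<lambda>x. F (h x))"
proof (rule pmf_eqI)
  fix g :: "'a \<Rightarrow> 'b"
  have inj: "inj (\<lambda>g :: 'a \<Rightarrow> 'b. g \<circ> h)"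
    by (rule injI) (use assms(2) in \<open>simp add: bij_is_surj surj_fun_eq comp_def fun_eq_iff, metis bij_inv_eq_iff\<close>)
  have g: "g = (g \<circ> inv h) \<circ> h"
    using assms(2) by (simp add: comp_assoc bij_is_inj)
  have memb: "h x \<in> h ` A \<longleftrightarrow> x \<in> A" for x
    using assms(2) by (simp add: bij_is_inj inj_image_mem_iff)
  have "pmf (map_pmf (\<lambda>g. g \<circ> h) (Pi_pmf (h ` A) d F)) g = pmf (Pi_pmf (h ` A) d F) (g \<circ> inv h)"
    by (subst g) (rule pmf_map_inj'[OF inj])
  also have "\<dots> = pmf (Pi_pmf A d (\<lambda>x. F (h x))) g"
  proof -
    have eq: "(\<forall>x. x \<notin> h ` A \<longrightarrow> (g \<circ> inv h) x = d) \<longleftrightarrow> (\<forall>x. x \<notin> A \<longrightarrow> g x = d)"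
      by (metis assms(2) memb bij_inv_eq_iff comp_apply)
    have "(\<Prod>x\<in>h ` A. pmf (F x) ((g \<circ> inv h) x)) = (\<Prod>x\<in>A. pmf (F (h x)) (g x))"
      using assms(2) by (subst prod.reindex) (auto simp: bij_is_inj intro: inj_on_subset[OF bij_is_inj])
    then show ?thesis
      by (simp only: pmf_Pi[OF assms(1)] pmf_Pi[OF finite_imageI[OF assms(1)]] eq)
  qed
  finally show "pmf (map_pmf (\<lambda>g. g \<circ> h) (Pi_pmf (h ` A) d F)) g
      = pmf (Pi_pmf A d (\<lambda>x. F (h x))) g" .
qed

context
  fixes \<pi> :: "nat \<Rightarrow> nat" and n :: nat
  assumes perm: "\<pi> permutes {1..n}"
begin

private lemma bij_pi: "bij \<pi>" using perm by (rule permutes_bij)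

private lemma bij_image_pi: "bij (image \<pi>)"
  by (metis bij_betw_Pow bij_pi Pow_UNIV)

private lemma image_all_edges: "image \<pi> ` all_edges n = all_edges n"
proof -
  have sub: "image \<sigma> ` all_edges n \<subseteq> all_edges n" if "\<sigma> permutes {1..n}" for \<sigma>
  proof
    fix x assume "x \<in> image \<sigma> ` all_edges n"
    then obtain e where e: "x = \<sigma> ` e" "e \<subseteq> {1..n}" "card e = 2" by (auto simp: all_edges_def)
    have "card (\<sigma> ` e) = 2"
      using e(3) permutes_inj_on[OF that] by (simp add: card_image)
    moreover have "\<sigma> ` e \<subseteq> {1..n}" using e(2) permutes_image[OF that] by blast
    ultimately show "x \<in> all_edges n" using e by (simp add: all_edges_def)
  qed
  have "x \<in> image \<pi> ` all_edges n" if "x \<in> all_edges n" for x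
  proof -
    have "x = \<pi> ` (inv \<pi> ` x)"
      using bij_pi by (simp add: image_comp bij_is_surj surj_iff[THEN iffD1])
    moreover have "inv \<pi> ` x \<in> all_edges n"
      using sub[OF permutes_inv[OF perm]] that by blast
    ultimately show ?thesis by blast
  qed
  with sub[OF perm] show ?thesis by blast
qed

private lemma gnp_invariant: "map_pmf (image (image \<pi>)) (gnp n p) = gnp n p"
proof -
  let ?P = "Pi_pmf (all_edges n) False (\<lambda>_. bernoulli_pmf p)"
  have P: "?P = map_pmf (\<lambda>g. g \<circ> image \<pi>) ?P"
    using Pi_pmf_reindex[OF finite_all_edges bij_image_pi, of n False "\<lambda>_. bernoulli_pmf p"]
    by (simp add: image_all_edges)
  have f: "image (image \<pi>) {e \<in> all_edges n. f (\<pi> ` e)} = {e \<in> all_edges n. f e}" for f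
  proof -
    have "{e \<in> all_edges n. f e} = {e \<in> image \<pi> ` all_edges n. f e}"
      by (simp only: image_all_edges)
    also have "\<dots> = image (image \<pi>) {e \<in> all_edges n. f (\<pi> ` e)}"
      by auto
    finally show ?thesis ..
  qed
  have "map_pmf (image (image \<pi>)) (gnp n p) = map_pmf (image (image \<pi>))
      (map_pmf (\<lambda>f. {e \<in> all_edges n. f e}) (map_pmf (\<lambda>g. g \<circ> image \<pi>) ?P))"
    by (simp only: gnp_def P[symmetric])
  also have "\<dots> = map_pmf (\<lambda>f. image (image \<pi>) {e \<in> all_edges n. f (\<pi> ` e)}) ?P"
    by (simp only: map_pmf_comp comp_def)
  also have "\<dots> = gnp n p" by (simp only: f gnp_def)
  finally show ?thesis .
qed

private lemma orientations_image: "orientations (\<pi> ` e) = map_prod \<pi> \<pi> ` orientations e"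
proof -
  have "(u, v) \<in> map_prod \<pi> \<pi> ` orientations e" if "\<pi> ` e = {u, v}" for u v
  proof -
    have "e = inv \<pi> ` {u, v}"
      using bij_pi that by (metis bij_is_inj image_inv_f_f)
    then have "(inv \<pi> u, inv \<pi> v) \<in> orientations e" by (simp add: orientations_def)
    moreover have "(u, v) = map_prod \<pi> \<pi> (inv \<pi> u, inv \<pi> v)"
      using bij_pi by (simp add: bij_is_surj surj_f_inv_f)
    ultimately show ?thesis by blast
  qed
  then show ?thesis by (auto simp: orientations_def)
qed

private lemma random_orientation_image:
  assumes "E \<subseteq> all_edges n"
  shows "random_orientation (image \<pi> ` E) =
    map_pmf (image (map_prod \<pi> \<pi>)) (random_orientation E)"
proof -
  let ?\<phi> = "map_prod \<pi> \<pi>" and ?U = "\<lambda>e. pmf_of_set (orientations e)"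
  have fin: "finite E" using assms finite_subset finite_all_edges by blast
  have U: "?U (\<pi> ` e) = map_pmf ?\<phi> (?U e)" if "e \<in> E" for e
  proof -
    have "card e = 2" using that assms by (auto simp: all_edges_def)
    moreover have "inj ?\<phi>" using bij_pi by (simp add: bij_is_inj prod.inj_map)
    ultimately show ?thesis
      by (subst map_pmf_of_set_inj)
        (auto simp: orientations_image card_2_orientations intro: inj_on_subset)
  qed
  have zero: "?\<phi> (0, 0) = (0, 0)" using perm by (simp add: permutes_not_in)
  have "random_orientation (image \<pi> ` E) =
      map_pmf (\<lambda>f. f ` E) (map_pmf (\<lambda>g. g \<circ> image \<pi>) (Pi_pmf (image \<pi> ` E) (0, 0) ?U))"
    unfolding random_orientation_def map_pmf_comp by (simp add: image_comp)
  also have "\<dots> = map_pmf (\<lambda>f. f ` E) (Pi_pmf E (0, 0) (\<lambda>e. ?U (\<pi> ` e)))"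
    by (subst Pi_pmf_reindex[OF fin bij_image_pi]) simp
  also have "\<dots> = map_pmf (\<lambda>f. f ` E) (Pi_pmf E (0, 0) (\<lambda>e. map_pmf ?\<phi> (?U e)))"
    using U by (intro arg_cong[where f = "map_pmf _"] Pi_pmf_cong) auto
  also have "\<dots> = map_pmf (\<lambda>f. f ` E) (map_pmf (\<lambda>f. ?\<phi> \<circ> f) (Pi_pmf E (0, 0) ?U))"
    using Pi_pmf_map[OF fin, of ?\<phi> "(0, 0)" "(0, 0)" ?U] zero by simp
  also have "\<dots> = map_pmf (image ?\<phi>) (random_orientation E)"
    by (simp add: random_orientation_def map_pmf_comp image_comp)
  finally show ?thesis .
qed

lemma dgnp_invariant: "map_pmf (image (map_prod \<pi> \<pi>)) (dgnp n p) = dgnp n p"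
proof -
  have sub: "E \<subseteq> all_edges n" if "E \<in> set_pmf (gnp n p)" for E
    using that by (auto simp: gnp_def)
  have "map_pmf (image (map_prod \<pi> \<pi>)) (dgnp n p) =
      bind_pmf (gnp n p) (\<lambda>E. map_pmf (image (map_prod \<pi> \<pi>)) (random_orientation E))"
    by (simp add: dgnp_def map_bind_pmf)
  also have "\<dots> = bind_pmf (gnp n p) (\<lambda>E. random_orientation (image \<pi> ` E))"
    using sub random_orientation_image by (intro bind_pmf_cong) auto
  also have "\<dots> = bind_pmf (map_pmf (image (image \<pi>)) (gnp n p)) random_orientation"
    by (simp add: bind_map_pmf)
  finally show ?thesis by (simp add: gnp_invariant dgnp_def)
qed

lemma rtrancl_relabel: "(\<pi> u, \<pi> v) \<in> (map_prod \<pi> \<pi> ` D)\<^sup>* \<longleftrightarrow> (u, v) \<in> D\<^sup>*"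
proof
  assume "(u, v) \<in> D\<^sup>*"
  then show "(\<pi> u, \<pi> v) \<in> (map_prod \<pi> \<pi> ` D)\<^sup>*"
  proof (induction rule: rtrancl_induct)
    case (step y z)
    have "(\<pi> y, \<pi> z) \<in> map_prod \<pi> \<pi> ` D" using step.hyps(2) by (rule map_prod_imageI)
    with step.IH show ?case by (rule rtrancl.rtrancl_into_rtrancl)
  qed simp
next
  have inv: "inv \<pi> (\<pi> a) = a" for a using bij_is_inj[OF bij_pi] by (rule inv_f_f)
  have "(u, inv \<pi> w) \<in> D\<^sup>*" if "(\<pi> u, w) \<in> (map_prod \<pi> \<pi> ` D)\<^sup>*" for w
    using that
  proof (induction rule: rtrancl_induct)
    case base
    show ?case by (simp only: inv rtrancl.rtrancl_refl)
  next
    case (step y z)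
    obtain a b where ab: "(a, b) \<in> D" "y = \<pi> a" "z = \<pi> b" using step.hyps(2) by blast
    have "(u, a) \<in> D\<^sup>*" using step.IH by (simp only: ab inv)
    then show ?case using ab(1) unfolding ab(3) inv by (rule rtrancl.rtrancl_into_rtrancl)
  qed
  moreover assume "(\<pi> u, \<pi> v) \<in> (map_prod \<pi> \<pi> ` D)\<^sup>*"
  ultimately have "(u, inv \<pi> (\<pi> v)) \<in> D\<^sup>*" by blast
  then show "(u, v) \<in> D\<^sup>*" by (simp only: inv)
qed

lemma clusters_relabel:
  "out_cluster (map_prod \<pi> \<pi> ` D) (\<pi> s) = \<pi> ` out_cluster D s"
  "in_cluster (map_prod \<pi> \<pi> ` D) (\<pi> s) = \<pi> ` in_cluster D s"
proof -
  have iff: "u \<in> \<pi> ` A \<longleftrightarrow> inv \<pi> u \<in> A" for u A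
    using bij_pi by (metis bij_inv_eq_iff image_iff)
  have inv: "\<pi> (inv \<pi> u) = u" for u using bij_is_surj[OF bij_pi] by (rule surj_f_inv_f)
  show "out_cluster (map_prod \<pi> \<pi> ` D) (\<pi> s) = \<pi> ` out_cluster D s"
  proof (rule set_eqI)
    fix u
    show "u \<in> out_cluster (map_prod \<pi> \<pi> ` D) (\<pi> s) \<longleftrightarrow> u \<in> \<pi> ` out_cluster D s"
      using rtrancl_relabel[of s "inv \<pi> u" D] by (simp only: iff inv out_cluster_def mem_Collect_eq)
  qed
  show "in_cluster (map_prod \<pi> \<pi> ` D) (\<pi> s) = \<pi> ` in_cluster D s"
  proof (rule set_eqI)
    fix u
    show "u \<in> in_cluster (map_prod \<pi> \<pi> ` D) (\<pi> s) \<longleftrightarrow> u \<in> \<pi> ` in_cluster D s"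
      using rtrancl_relabel[of "inv \<pi> u" s D] by (simp only: iff inv in_cluster_def mem_Collect_eq)
  qed
qed

lemma prob_relabel:
  assumes "\<And>D. P (map_prod \<pi> \<pi> ` D) \<longleftrightarrow> Q D"
  shows "measure_pmf.prob (dgnp n p) {D. P D} = measure_pmf.prob (dgnp n p) {D. Q D}"
proof -
  have "measure_pmf.prob (dgnp n p) {D. P D}
      = measure_pmf.prob (map_pmf (image (map_prod \<pi> \<pi>)) (dgnp n p)) {D. P D}"
    by (simp add: dgnp_invariant)
  also have "\<dots> = measure_pmf.prob (dgnp n p) {D. Q D}"
    using assms by (simp add: vimage_def)
  finally show ?thesis .
qed

lemma image_eq_iff: "\<pi> ` A = \<pi> ` B \<longleftrightarrow> A = B"
  using bij_pi by (simp add: bij_is_inj inj_image_eq_iff)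

end

lemma exists_relabelling:
  fixes f f' :: "nat \<Rightarrow> 'c"
  assumes "\<And>c. card {x \<in> {1..n}. f x = c} = card {x \<in> {1..n}. f' x = c}"
  obtains \<pi> where "\<pi> permutes {1..n}" "\<forall>x\<in>{1..n}. f x = f' (\<pi> x)"
proof -
  have "image_mset f (mset_set {1..n}) = image_mset f' (mset_set {1..n})"
  proof (rule multiset_eqI)
    fix c
    have "count (image_mset g (mset_set {1..n})) c = card {x \<in> {1..n}. g x = c}"
      for g :: "nat \<Rightarrow> 'c"
    proof -
      have "{x. x \<in># mset_set {1..n} \<and> c = g x} = {x \<in> {1..n}. g x = c}" by auto
      then show ?thesis by (simp add: count_image_mset')
    qed
    with assms show "count (image_mset f (mset_set {1..n})) c
        = count (image_mset f' (mset_set {1..n})) c" by simp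
  qed
  from image_mset_eq_implies_permutes[OF _ this] that show thesis by auto
qed

lemma permutes_image_eq:
  fixes \<pi> :: "nat \<Rightarrow> nat"
  assumes "\<pi> permutes {1..n}" "X \<subseteq> {1..n}" "X' \<subseteq> {1..n}"
    and "\<And>x. x \<in> {1..n} \<Longrightarrow> x \<in> X \<longleftrightarrow> \<pi> x \<in> X'"
  shows "\<pi> ` X = X'"
proof
  show "\<pi> ` X \<subseteq> X'" using assms by auto
  show "X' \<subseteq> \<pi> ` X"
  proof
    fix x assume x: "x \<in> X'"
    then obtain w where "w \<in> {1..n}" "x = \<pi> w"
      using assms(1,3) permutes_image by blast
    with x assms(4) show "x \<in> \<pi> ` X" by blast
  qed
qed

lemma finite_vertices: "X \<subseteq> {1..n} \<Longrightarrow> finite X" for X :: "nat set"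
  by (rule finite_subset) auto

lemma M_prob_relabel:
  fixes s s' n :: nat and X Y X' Y' :: "nat set"
  assumes "s \<in> X" "X \<subseteq> {1..n}" "s \<in> Y" "Y \<subseteq> {1..n}"
    and "s' \<in> X'" "X' \<subseteq> {1..n}" "s' \<in> Y'" "Y' \<subseteq> {1..n}"
    and "card X = card X'" "card Y = card Y'"
    and "card ({1..n} - (Y \<union> X)) = card ({1..n} - (Y' \<union> X'))"
  obtains \<pi> where "\<pi> permutes {1..n}" "\<pi> s = s'" "\<pi> ` X = X'" "\<pi> ` Y = Y'"
proof -
  have fin: "finite X" "finite Y" "finite X'" "finite Y'"
    using finite_vertices[OF assms(2)] finite_vertices[OF assms(4)]
      finite_vertices[OF assms(6)] finite_vertices[OF assms(8)] by auto
  have un: "card (X \<union> Y) = card (X' \<union> Y')"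
  proof -
    have "card ({1..n} - (Y \<union> X)) + card (X \<union> Y) = n"
      if "X \<subseteq> {1..n}" "Y \<subseteq> {1..n}" for X Y
    proof -
      have "card (X \<union> Y) \<le> card {1..n}" using that by (intro card_mono) auto
      moreover have "card ({1..n} - (Y \<union> X)) = card {1..n} - card (X \<union> Y)"
        using that finite_subset[OF _ finite_atLeastAtMost, of "Y \<union> X" 1 n]
        by (subst card_Diff_subset) (auto simp: Un_commute)
      ultimately show ?thesis by simp
    qed
    from this[OF assms(2,4)] this[OF assms(6,8)] assms(11) show ?thesis by linarith
  qed
  have int: "card (X \<inter> Y) = card (X' \<inter> Y')"
    using card_Un_Int[OF fin(1,2)] card_Un_Int[OF fin(3,4)] un assms(9,10) by linarith
  let ?f = "\<lambda>x. (x = s, x \<in> X, x \<in> Y)" and ?f' = "\<lambda>x. (x = s', x \<in> X', x \<in> Y')"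
  have fib: "card {x \<in> {1..n}. (x = s, x \<in> X, x \<in> Y) = c} = (case c of
      (True, a, b) \<Rightarrow> (if a \<and> b then 1 else 0)
    | (False, True, True) \<Rightarrow> card (X \<inter> Y) - 1
    | (False, True, False) \<Rightarrow> card X - card (X \<inter> Y)
    | (False, False, True) \<Rightarrow> card Y - card (X \<inter> Y)
    | (False, False, False) \<Rightarrow> card ({1..n} - (Y \<union> X)))"
    if "s \<in> X" "X \<subseteq> {1..n}" "s \<in> Y" "Y \<subseteq> {1..n}" for s X Y c
  proof -
    have fin: "finite X" "finite Y"
      using finite_vertices[OF that(2)] finite_vertices[OF that(4)] by auto
    obtain c1 c2 c3 where c: "c = (c1, c2, c3)" by (cases c)
    let ?S = "{x \<in> {1..n}. (x = s, x \<in> X, x \<in> Y) = c}"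
    consider "c1" | "\<not> c1" "c2" "c3" | "\<not> c1" "c2" "\<not> c3" | "\<not> c1" "\<not> c2" "c3"
      | "\<not> c1" "\<not> c2" "\<not> c3" by blast
    then show ?thesis
    proof cases
      case 1
      have "?S = (if c2 \<and> c3 then {s} else {})" using that 1 c by auto
      then have "card ?S = (if c2 \<and> c3 then 1 else 0)" by simp
      then show ?thesis using 1 c by simp
    next
      case 2
      have "?S = X \<inter> Y - {s}" using that 2 c by auto
      then have "card ?S = card (X \<inter> Y) - 1" using that by simp
      then show ?thesis using 2 c by simp
    next
      case 3
      have "?S = X - X \<inter> Y" using that 3 c by auto
      then have "card ?S = card X - card (X \<inter> Y)" using fin by (simp add: card_Diff_subset)
      then show ?thesis using 3 c by simp
    next
      case 4
      have "?S = Y - X \<inter> Y" using that 4 c by auto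
      then have "card ?S = card Y - card (X \<inter> Y)" using fin by (simp add: card_Diff_subset)
      then show ?thesis using 4 c by simp
    next
      case 5
      have "?S = {1..n} - (Y \<union> X)" using that 5 c by auto
      then have "card ?S = card ({1..n} - (Y \<union> X))" by simp
      then show ?thesis using 5 c by simp
    qed
  qed
  have "card {x \<in> {1..n}. ?f x = c} = card {x \<in> {1..n}. ?f' x = c}" for c
    unfolding fib[OF assms(1-4)] fib[OF assms(5-8)] int assms(9-11) ..
  then obtain \<pi> where \<pi>: "\<pi> permutes {1..n}" "\<forall>x\<in>{1..n}. ?f x = ?f' (\<pi> x)"
    by (rule exists_relabelling)
  have "s \<in> {1..n}" using assms(1,2) by blast
  then have "\<pi> s = s'" using \<pi>(2) by blast
  moreover have "\<pi> ` X = X'" "\<pi> ` Y = Y'"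
    using permutes_image_eq[OF \<pi>(1) assms(2,6)] permutes_image_eq[OF \<pi>(1) assms(4,8)] \<pi>(2)
    by auto
  ultimately show thesis using that \<pi>(1) by blast
qed

lemma M_prob_eq:
  assumes "s \<in> X" "X \<subseteq> {1..n}" "s \<in> Y" "Y \<subseteq> {1..n}"
    and "card X = k" "card Y = m" "card ({1..n} - (Y \<union> X)) = r"
  shows "M_prob p n k m r =
    measure_pmf.prob (dgnp n p) {D. out_cluster D s = X \<and> in_cluster D s = Y}"
  unfolding M_prob_def
proof (rule the_equality, intro allI impI)
  fix s' X' Y'
  assume A: "s' \<in> X' \<and> X' \<subseteq> {1..n} \<and> s' \<in> Y' \<and> Y' \<subseteq> {1..n} \<and>
    card X' = k \<and> card Y' = m \<and> card ({1..n} - (Y' \<union> X')) = r"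
  then obtain \<pi> where \<pi>: "\<pi> permutes {1..n}" "\<pi> s = s'" "\<pi> ` X = X'" "\<pi> ` Y = Y'"
    using M_prob_relabel[OF assms(1-4), of s' X' Y'] assms(5-7) by auto
  show "measure_pmf.prob (dgnp n p) {D. out_cluster D s = X \<and> in_cluster D s = Y} =
    measure_pmf.prob (dgnp n p) {D. out_cluster D s' = X' \<and> in_cluster D s' = Y'}"
    by (rule prob_relabel[OF \<pi>(1), symmetric])
      (simp add: \<pi>(2-4)[symmetric] clusters_relabel[OF \<pi>(1)] image_eq_iff[OF \<pi>(1)])
next
  fix x
  assume "\<forall>s X Y. s \<in> X \<and> X \<subseteq> {1..n} \<and> s \<in> Y \<and> Y \<subseteq> {1..n} \<and>
     card X = k \<and> card Y = m \<and> card ({1..n} - (Y \<union> X)) = r \<longrightarrow>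
     x = measure_pmf.prob (dgnp n p) {D. out_cluster D s = X \<and> in_cluster D s = Y}"
  with assms show "x =
    measure_pmf.prob (dgnp n p) {D. out_cluster D s = X \<and> in_cluster D s = Y}" by blast
qed

lemma d_prob_eq:
  assumes "s \<in> X" "X \<subseteq> {1..n}" "card X = k"
  shows "d_prob p n k = measure_pmf.prob (dgnp n p) {D. out_cluster D s = X}"
  unfolding d_prob_def
proof (rule the_equality, intro allI impI)
  fix s' X'
  assume A: "s' \<in> X' \<and> X' \<subseteq> {1..n} \<and> card X' = k"
  then obtain \<pi> where \<pi>: "\<pi> permutes {1..n}" "\<pi> s = s'" "\<pi> ` X = X'"
  proof -
    have "card ({1..n} - (X \<union> X)) = card ({1..n} - (X' \<union> X'))"
      using A assms card_Diff_subset[OF finite_vertices[of X n]]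
        card_Diff_subset[OF finite_vertices[of X' n]] by simp
    then show thesis
      using M_prob_relabel[of s X n X s' X' X'] A assms that by auto
  qed
  show "measure_pmf.prob (dgnp n p) {D. out_cluster D s = X} =
    measure_pmf.prob (dgnp n p) {D. out_cluster D s' = X'}"
    by (rule prob_relabel[OF \<pi>(1), symmetric])
      (simp add: \<pi>(2-3)[symmetric] clusters_relabel[OF \<pi>(1)] image_eq_iff[OF \<pi>(1)])
next
  fix x
  assume "\<forall>s X. s \<in> X \<and> X \<subseteq> {1..n} \<and> card X = k \<longrightarrow>
     x = measure_pmf.prob (dgnp n p) {D. out_cluster D s = X}"
  with assms show "x = measure_pmf.prob (dgnp n p) {D. out_cluster D s = X}" by blast
qed

lemma g_prob_eq:
  assumes "a \<in> {1..n}" "s \<in> {1..n}" "b \<in> {1..n}" "a \<noteq> s" "s \<noteq> b" "a \<noteq> b"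
  shows "g_prob n p = measure_pmf.prob (dgnp n p) {D. (a, s) \<notin> D\<^sup>* \<and> (s, b) \<notin> D\<^sup>*}"
  unfolding g_prob_def
proof (rule the_equality, intro allI impI)
  fix a' s' b'
  assume A: "a' \<in> {1..n} \<and> s' \<in> {1..n} \<and> b' \<in> {1..n} \<and> a' \<noteq> s' \<and> s' \<noteq> b' \<and> a' \<noteq> b'"
  obtain \<pi> where \<pi>: "\<pi> permutes {1..n}" "\<pi> s = s'" "\<pi> ` {s, a} = {s', a'}" "\<pi> ` {s, b} = {s', b'}"
    by (rule M_prob_relabel[of s "{s, a}" n "{s, b}" s' "{s', a'}" "{s', b'}"])
      (use A assms in \<open>auto simp: card_Diff_subset card_insert_if\<close>)
  have "inj \<pi>" using \<pi>(1) by (rule permutes_inj)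
  then have ab: "\<pi> a = a'" "\<pi> b = b'"
    using \<pi>(2-4) assms A by (auto simp: doubleton_eq_iff)
  show "measure_pmf.prob (dgnp n p) {D. (a, s) \<notin> D\<^sup>* \<and> (s, b) \<notin> D\<^sup>*} =
    measure_pmf.prob (dgnp n p) {D. (a', s') \<notin> D\<^sup>* \<and> (s', b') \<notin> D\<^sup>*}"
    by (rule prob_relabel[OF \<pi>(1), symmetric])
      (simp add: \<pi>(2)[symmetric] ab[symmetric] rtrancl_relabel[OF \<pi>(1)])
next
  fix x
  assume "\<forall>a s b. a \<in> {1..n} \<and> s \<in> {1..n} \<and> b \<in> {1..n} \<and> a \<noteq> s \<and> s \<noteq> b \<and> a \<noteq> b \<longrightarrow>
     x = measure_pmf.prob (dgnp n p) {D. (a, s) \<notin> D\<^sup>* \<and> (s, b) \<notin> D\<^sup>*}"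
  with assms show "x = measure_pmf.prob (dgnp n p) {D. (a, s) \<notin> D\<^sup>* \<and> (s, b) \<notin> D\<^sup>*}"
    by blast
qed

end

theory Submission
  imports Defs
begin

text \<open>The random digraph arises from independent choices for the vertex pairs: a pair carries no arc
  with probability \<open>q = 1 - p\<close> and each of its two orientations with probability \<open>p / 2\<close>. Forbidding
  one orientation of a pair therefore costs a factor \<open>y = 1 - p / 2\<close>, forbidding both costs \<open>q\<close>, and
  conditions on disjoint sets of pairs multiply. With this, every identity reduces to a
  deterministic statement about reachability and a count of pairs.

  Let \<open>X\<close> and \<open>Y\<close> be the out-cluster and the in-cluster of \<open>s\<close>. If \<open>r\<close> vertices lie in neither of
  them, these are cut off from \<open>X\<close> in one direction and from \<open>Y\<close> in the other, and the rest of the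
  event takes place inside \<open>X \<union> Y\<close> (\<open>prob_clusters_restrict\<close>); this is the reduction to \<open>r = 0\<close>. For
  the recursion, where \<open>X \<union> Y\<close> is everything, a vertex \<open>w\<close> outside \<open>X\<close> is fixed and the event is split
  by the set \<open>J\<close> of those vertices outside \<open>X\<close> that can reach \<open>s\<close> only through \<open>w\<close>. For fixed \<open>J\<close> the
  event factors into a cluster event on the remaining vertices, the event that all of \<open>J\<close> reaches
  \<open>w\<close> inside \<open>J\<close>, and an event about the pairs between the two parts (\<open>gateway_decomposition\<close>,
  \<open>prob_gateway\<close>). The symmetry in \<open>k\<close> and \<open>m\<close> comes from reversing all arcs (\<open>arcs_pmf_converse\<close>).
  The formulas for \<open>M_prob p n n n 0\<close> and \<open>g_prob n p\<close> combine the law of total probability over the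
  values of \<open>(X, Y)\<close> (\<open>prob_by_clusters\<close>) with the number of pairs \<open>(X, Y)\<close> of given sizes
  (\<open>sum_cluster_pairs\<close>); for \<open>g_prob n p\<close> the probability is first averaged over all choices of \<open>a\<close>
  and \<open>b\<close>.\<close>

section \<open>Random digraphs with independent vertex pairs\<close>

definition edges_on :: "nat set \<Rightarrow> nat set set" where
  "edges_on V = {e. e \<subseteq> V \<and> card e = 2}"

definition arcs_of :: "nat set set \<Rightarrow> nat rel" where
  "arcs_of E = (\<Union>e\<in>E. orientations e)"

definition arc_pmf :: "real \<Rightarrow> nat set \<Rightarrow> nat rel pmf" where
  "arc_pmf p e = bernoulli_pmf p \<bind>
     (\<lambda>present. if present then map_pmf (\<lambda>a. {a}) (pmf_of_set (orientations e)) else return_pmf {})"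

text \<open>The edge set is arbitrary here, so that the same family of distributions describes the random
  digraph on any vertex set and also its parts, such as the arcs between two disjoint vertex sets.\<close>

definition arcs_pmf :: "real \<Rightarrow> nat set set \<Rightarrow> nat rel pmf" where
  "arcs_pmf p E = map_pmf (\<lambda>f. \<Union>e\<in>E. f e) (Pi_pmf E {} (arc_pmf p))"

lemma edges_on_cases:
  assumes "e \<in> edges_on V"
  obtains u v where "e = {u, v}" "u \<noteq> v" "u \<in> V" "v \<in> V" "orientations e = {(u, v), (v, u)}"
proof -
  obtain u v where "e = {u, v}" "u \<noteq> v" using assms by (auto simp: edges_on_def card_2_iff)
  then show ?thesis using that[of u v] assms
    by (auto simp: edges_on_def orientations_def doubleton_eq_iff)
qed

lemma finite_edges_on [simp]: "finite V \<Longrightarrow> finite (edges_on V)"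
  by (rule finite_subset[of _ "Pow V"]) (auto simp: edges_on_def)

lemma edges_on_mono: "U \<subseteq> V \<Longrightarrow> edges_on U \<subseteq> edges_on V"
  by (auto simp: edges_on_def)

lemma arcs_of_iff: "(u, v) \<in> arcs_of E \<longleftrightarrow> {u, v} \<in> E"
  by (auto simp: arcs_of_def orientations_def)

lemma arcs_of_edges_on: "arcs_of (edges_on V) = V \<times> V - Id"
  by (auto simp: arcs_of_iff edges_on_def card_insert_if split: if_splits)

lemma arcs_of_mono: "E \<subseteq> E' \<Longrightarrow> arcs_of E \<subseteq> arcs_of E'"
  by (auto simp: arcs_of_def)

text \<open>In \<^const>\<open>dgnp\<close> all edges are chosen before any is oriented. Since the choices for
  different edges are independent, the two rounds can be interchanged: each edge may be chosen and
  oriented on its own.\<close>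

lemma dgnp_eq_arcs_pmf: "dgnp n p = arcs_pmf p (edges_on {1..n})"
proof -
  define E where "E = edges_on {1..n}"
  let ?U = "\<lambda>e. pmf_of_set (orientations e)" and ?S = "\<lambda>a :: nat \<times> nat. {a}"
  have E: "all_edges n = E" "finite E" by (simp_all add: E_def edges_on_def all_edges_def)
  have orient: "random_orientation {e \<in> E. b e} =
      map_pmf (\<lambda>f. \<Union>e\<in>E. f e) (Pi_pmf E {} (\<lambda>e. if b e then map_pmf ?S (?U e) else return_pmf {}))"
    for b
  proof -
    let ?B = "{e \<in> E. b e}"
    have fin: "finite ?B" using E by simp
    \<comment> \<open>To push the product through \<open>\<lambda>a. {a}\<close>, the default value \<open>(0, 0)\<close> has to be mapped to the
      new default, which is therefore changed from \<open>{}\<close> to \<open>{(0, 0)}\<close> first.\<close>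
    have "Pi_pmf E {} (\<lambda>e. if b e then map_pmf ?S (?U e) else return_pmf {})
        = Pi_pmf ?B {} (\<lambda>e. map_pmf ?S (?U e))"
      by (rule Pi_pmf_if_set[OF E(2)])
    also have "\<dots> = map_pmf (\<lambda>f x. if x \<in> ?B then f x else {})
        (Pi_pmf ?B {(0, 0)} (\<lambda>e. map_pmf ?S (?U e)))"
      by (rule Pi_pmf_default_swap[OF fin, symmetric])
    also have "Pi_pmf ?B {(0, 0)} (\<lambda>e. map_pmf ?S (?U e))
        = map_pmf (\<lambda>f. ?S \<circ> f) (Pi_pmf ?B (0, 0) ?U)"
      by (rule Pi_pmf_map[OF fin]) simp
    finally have "map_pmf (\<lambda>f. \<Union>e\<in>E. f e)
        (Pi_pmf E {} (\<lambda>e. if b e then map_pmf ?S (?U e) else return_pmf {})) =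
      map_pmf (\<lambda>f. \<Union>e\<in>E. if e \<in> ?B then {f e} else {}) (Pi_pmf ?B (0, 0) ?U)"
      by (simp add: map_pmf_comp o_def)
    also have "(\<lambda>f :: nat set \<Rightarrow> nat \<times> nat. \<Union>e\<in>E. if e \<in> ?B then {f e} else {}) = (\<lambda>f. f ` ?B)"
      by (auto split: if_splits)
    finally show ?thesis by (simp add: random_orientation_def)
  qed
  have "dgnp n p = Pi_pmf E False (\<lambda>_. bernoulli_pmf p) \<bind>
      (\<lambda>b. random_orientation {e \<in> E. b e})"
    by (simp add: dgnp_def gnp_def E bind_map_pmf)
  also have "\<dots> = map_pmf (\<lambda>f. \<Union>e\<in>E. f e) (Pi_pmf E False (\<lambda>_. bernoulli_pmf p) \<bind>
      (\<lambda>b. Pi_pmf E {} (\<lambda>e. if b e then map_pmf ?S (?U e) else return_pmf {})))"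
    by (simp add: orient map_bind_pmf)
  also have "\<dots> = arcs_pmf p E"
    unfolding arcs_pmf_def arc_pmf_def
    by (subst Pi_pmf_bind[OF E(2), where d' = False]) simp
  finally show ?thesis by (simp add: E_def)
qed

lemma prob_pmf_cong:
  assumes "\<And>D. D \<in> set_pmf M \<Longrightarrow> P D \<longleftrightarrow> Q D"
  shows "measure_pmf.prob M {D. P D} = measure_pmf.prob M {D. Q D}"
  by (rule measure_prob_cong_0) (use assms in \<open>auto simp: pmf_eq_0_set_pmf\<close>)

lemma prob_pair_pmf:
  "measure_pmf.prob (pair_pmf M N) {(a, b). P a \<and> Q b} =
    measure_pmf.prob M {a. P a} * measure_pmf.prob N {b. Q b}"
proof -
  have "measure_pmf.prob (pair_pmf M N) {(a, b). P a \<and> Q b} =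
      measure_pmf.prob (pair_pmf M N) (({a. P a} \<inter> set_pmf M) \<times> ({b. Q b} \<inter> set_pmf N))"
    by (rule measure_prob_cong_0) (auto simp: pmf_eq_0_set_pmf)
  also have "\<dots> = measure_pmf.prob M ({a. P a} \<inter> set_pmf M) * measure_pmf.prob N ({b. Q b} \<inter> set_pmf N)"
    by (rule measure_pmf_prob_product) (auto intro: countable_Int2)
  finally show ?thesis by (simp add: measure_Int_set_pmf)
qed

lemma set_arc_pmf:
  assumes "e \<in> edges_on V" "a \<in> set_pmf (arc_pmf p e)"
  shows "a \<subseteq> orientations e"
proof -
  have "finite (orientations e)" "orientations e \<noteq> {}"
    using assms(1) card_2_orientations[of e] by (auto simp: edges_on_def)
  then show ?thesis
    using assms(2) by (auto simp: arc_pmf_def set_pmf_of_set split: if_splits)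
qed

lemma set_arcs_pmf:
  assumes "E \<subseteq> edges_on V" "finite E" "D \<in> set_pmf (arcs_pmf p E)"
  shows "D \<subseteq> arcs_of E"
proof -
  obtain f where f: "D = (\<Union>e\<in>E. f e)" "f \<in> set_pmf (Pi_pmf E {} (arc_pmf p))"
    using assms(3) by (auto simp: arcs_pmf_def)
  then have "f e \<subseteq> orientations e" if "e \<in> E" for e
    using that assms(1) set_arc_pmf[of e V "f e" p] set_Pi_pmf[OF assms(2), of "{}" "arc_pmf p"]
    by (auto simp: PiE_dflt_def)
  then show ?thesis unfolding f arcs_of_def by blast
qed

lemma arcs_pmf_Un:
  assumes "finite E1" "finite E2" "E1 \<inter> E2 = {}"
  shows "arcs_pmf p (E1 \<union> E2) = map_pmf (\<lambda>(D1, D2). D1 \<union> D2) (pair_pmf (arcs_pmf p E1) (arcs_pmf p E2))"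
proof -
  have eq: "(\<Union>e\<in>E1 \<union> E2. if e \<in> E1 then f e else g e) = (\<Union>e\<in>E1. f e) \<union> (\<Union>e\<in>E2. g e)"
    for f g :: "nat set \<Rightarrow> nat rel"
    using assms(3) by (fastforce split: if_splits)
  show ?thesis
    unfolding arcs_pmf_def Pi_pmf_union[OF assms] map_pair[symmetric] map_pmf_comp
    by (intro map_pmf_cong refl) (simp only: eq split_beta fst_conv snd_conv)
qed

text \<open>This is the form in which independence is used: an event that splits into a condition on the
  arcs over \<open>E1\<close> and a condition on the arcs over \<open>E2\<close> has the product of the two probabilities.\<close>

lemma prob_arcs_pmf_Un:
  assumes "E \<subseteq> edges_on V" "finite E" "E = E1 \<union> E2" "E1 \<inter> E2 = {}"
    and "\<And>D. D \<subseteq> arcs_of E \<Longrightarrow> S D \<longleftrightarrow> P (D \<inter> arcs_of E1) \<and> Q (D \<inter> arcs_of E2)"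
  shows "measure_pmf.prob (arcs_pmf p E) {D. S D} =
    measure_pmf.prob (arcs_pmf p E1) {D. P D} * measure_pmf.prob (arcs_pmf p E2) {D. Q D}"
proof -
  have fin: "finite E1" "finite E2" and sub: "E1 \<subseteq> edges_on V" "E2 \<subseteq> edges_on V"
    using assms(1-3) by auto
  have disj: "arcs_of E1 \<inter> arcs_of E2 = {}"
    using assms(4) by (auto simp: arcs_of_iff)
  have "measure_pmf.prob (arcs_pmf p E) {D. S D} =
      measure_pmf.prob (pair_pmf (arcs_pmf p E1) (arcs_pmf p E2)) {z. case z of (D1, D2) \<Rightarrow> S (D1 \<union> D2)}"
    unfolding assms(3) arcs_pmf_Un[OF fin assms(4)] by (simp add: vimage_def split_beta)
  also have "\<dots> = measure_pmf.prob (pair_pmf (arcs_pmf p E1) (arcs_pmf p E2))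
      {z. case z of (D1, D2) \<Rightarrow> P D1 \<and> Q D2}"
  proof (rule prob_pmf_cong)
    fix z assume z: "z \<in> set_pmf (pair_pmf (arcs_pmf p E1) (arcs_pmf p E2))"
    obtain D1 D2 where D: "z = (D1, D2)" by (cases z)
    have s: "D1 \<subseteq> arcs_of E1" "D2 \<subseteq> arcs_of E2"
      using z D set_arcs_pmf[OF sub(1) fin(1), of D1] set_arcs_pmf[OF sub(2) fin(2), of D2] by auto
    then have "(D1 \<union> D2) \<inter> arcs_of E1 = D1" "(D1 \<union> D2) \<inter> arcs_of E2 = D2"
      using disj by auto
    moreover have "D1 \<union> D2 \<subseteq> arcs_of E"
      using s unfolding assms(3) by (auto simp: arcs_of_def)
    ultimately show "(case z of (D1, D2) \<Rightarrow> S (D1 \<union> D2)) = (case z of (D1, D2) \<Rightarrow> P D1 \<and> Q D2)"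
      using assms(5)[of "D1 \<union> D2"] D by simp
  qed
  also have "\<dots> = measure_pmf.prob (arcs_pmf p E1) {D. P D} * measure_pmf.prob (arcs_pmf p E2) {D. Q D}"
    by (rule prob_pair_pmf)
  finally show ?thesis .
qed

lemma prob_arc_avoids:
  assumes "0 \<le> p" "p \<le> 1" "u \<noteq> v"
  shows "measure_pmf.prob (arc_pmf p {u, v}) {a. a \<inter> F = {}} =
    1 - p / 2 * of_bool ((u, v) \<in> F) - p / 2 * of_bool ((v, u) \<in> F)"
proof -
  have o: "orientations {u, v} = {(u, v), (v, u)}"
    by (auto simp: orientations_def doubleton_eq_iff)
  have "measure_pmf.prob (arc_pmf p {u, v}) {a. a \<inter> F = {}} =
      p * measure_pmf.prob (map_pmf (\<lambda>a. {a}) (pmf_of_set (orientations {u, v}))) {a. a \<inter> F = {}} + (1 - p)"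
    unfolding arc_pmf_def measure_pmf_bind using assms
    by (subst measure_pmf.measure_bind[where N = "count_space UNIV"])
       (auto simp: measure_return measure_pmf_in_subprob_algebra)
  also have "\<dots> = p * (card ({(u, v), (v, u)} - F) / 2) + (1 - p)"
    using assms(3) by (simp add: o measure_pmf_of_set vimage_def Diff_eq Compl_eq insert_commute)
  also have "\<dots> = 1 - p / 2 * of_bool ((u, v) \<in> F) - p / 2 * of_bool ((v, u) \<in> F)"
    using assms(3) by (auto simp: insert_Diff_if field_simps)
  finally show ?thesis .
qed

section \<open>The probability of avoiding a set of arcs\<close>

text \<open>The set \<open>S\<close> consists of the forbidden arcs whose reversal is allowed; each costs a factor
  \<open>1 - p / 2\<close>. The set \<open>B\<close> contains one orientation of every pair for which both orientations are
  forbidden; such a pair has to carry no edge, which costs \<open>1 - p\<close>. The disjointness conditions say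
  that no pair is counted twice, so that the exponents are plain cardinalities of arc sets.\<close>

lemma prob_arcs_avoid:
  assumes "0 \<le> p" "p \<le> 1" "finite V" "E \<subseteq> edges_on V"
    and "S \<subseteq> arcs_of E" "B \<subseteq> arcs_of E"
    and "S \<inter> S\<inverse> = {}" "B \<inter> B\<inverse> = {}" "S \<inter> (B \<union> B\<inverse>) = {}"
    and "F = S \<union> B \<union> B\<inverse>"
  shows "measure_pmf.prob (arcs_pmf p E) {D. D \<inter> F = {}} = (1 - p / 2) ^ card S * (1 - p) ^ card B"
proof -
  define ed where "ed = (\<lambda>(u, v). {u, v :: nat})"
  let ?g = "\<lambda>e. measure_pmf.prob (arc_pmf p e) {a. a \<inter> F = {}}"
  have fin: "finite E" using assms(3,4) finite_edges_on finite_subset by blast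
  have ne: "u \<noteq> v" if "(u, v) \<in> arcs_of E" for u v
    using that assms(4) by (auto simp: arcs_of_iff edges_on_def card_insert_if)
  have "finite (arcs_of E)"
    by (rule finite_subset[OF arcs_of_mono[OF assms(4)]]) (simp add: arcs_of_edges_on assms(3))
  then have finS: "finite S" "finite B" using assms(5,6) finite_subset by auto
  have inj: "inj_on ed S" "inj_on ed B"
    using assms(7,8) by (auto simp: inj_on_def ed_def doubleton_eq_iff)
  have disj: "ed ` S \<inter> ed ` B = {}"
    using assms(9) by (auto simp: ed_def doubleton_eq_iff)
  have sub: "ed ` S \<union> ed ` B \<subseteq> E"
    using assms(5,6) by (auto simp: ed_def arcs_of_iff)
  have eqv: "ed a \<in> ed ` S \<longleftrightarrow> a \<in> S \<or> prod.swap a \<in> S"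
    "ed a \<in> ed ` B \<longleftrightarrow> a \<in> B \<or> prod.swap a \<in> B" for a
    by (cases a; force simp: ed_def doubleton_eq_iff image_iff)+
  have factor: "?g (ed (u, v)) = 1 - p / 2 * of_bool ((u, v) \<in> F) - p / 2 * of_bool ((v, u) \<in> F)"
    if "(u, v) \<in> arcs_of E" for u v
    using prob_arc_avoids[OF assms(1,2) ne[OF that]] by (simp add: ed_def)
  have gS: "?g (ed a) = 1 - p / 2" if "a \<in> S" for a
  proof -
    obtain u v where a: "a = (u, v)" by (cases a)
    have "(u, v) \<in> F" "(v, u) \<notin> F" using that a assms(7,9,10) by auto
    then show ?thesis using factor[of u v] that a assms(5) by auto
  qed
  have gB: "?g (ed a) = 1 - p" if "a \<in> B" for a
  proof -
    obtain u v where a: "a = (u, v)" by (cases a)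
    have "(u, v) \<in> F" "(v, u) \<in> F" using that a assms(10) by auto
    then show ?thesis using factor[of u v] that a assms(6) by auto
  qed
  have g1: "?g e = 1" if "e \<in> E - (ed ` S \<union> ed ` B)" for e
  proof -
    have "e \<in> edges_on V" using that assms(4) by blast
    then obtain u v where "e = {u, v}" by (rule edges_on_cases)
    then have e: "e = ed (u, v)" "(u, v) \<in> arcs_of E"
      using that by (auto simp: ed_def arcs_of_iff)
    have "(u, v) \<notin> F" "(v, u) \<notin> F" using that e(1) eqv[of "(u, v)"] assms(10) by auto
    then show ?thesis using factor[OF e(2)] e(1) by simp
  qed
  have "measure_pmf.prob (arcs_pmf p E) {D. D \<inter> F = {}} =
      measure_pmf.prob (Pi_pmf E {} (arc_pmf p)) (Pi E (\<lambda>_. {a. a \<inter> F = {}}))"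
    unfolding arcs_pmf_def by (auto simp: vimage_def Pi_def intro!: arg_cong[where f = "measure_pmf.prob _"])
  also have "\<dots> = prod ?g E" by (rule measure_Pi_pmf_Pi[OF fin])
  also have "\<dots> = prod ?g (ed ` S \<union> ed ` B)"
    using fin sub g1 by (intro prod.mono_neutral_right) auto
  also have "\<dots> = prod ?g (ed ` S) * prod ?g (ed ` B)"
    using finS disj by (intro prod.union_disjoint) auto
  also have "\<dots> = (1 - p / 2) ^ card S * (1 - p) ^ card B"
    by (simp add: prod.reindex inj gS gB)
  finally show ?thesis .
qed

section \<open>Relabelling vertices and reversing arcs\<close>

lemma arc_pmf_image:
  assumes "e \<in> edges_on V" "bij h"
  shows "arc_pmf p (h ` e) = map_pmf (image (map_prod h h)) (arc_pmf p e)"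
proof -
  let ?\<phi> = "map_prod h h"
  obtain u v where e: "e = {u, v}" "orientations e = {(u, v), (v, u)}"
    using assms(1) by (rule edges_on_cases)
  have "orientations (h ` e) = ?\<phi> ` orientations e"
    unfolding e(2) by (auto simp: e(1) orientations_def doubleton_eq_iff)
  moreover have "inj ?\<phi>"
    using assms(2) by (simp add: bij_is_inj prod.inj_map)
  then have "inj_on ?\<phi> (orientations e)"
    by (rule inj_on_subset) simp
  ultimately have "pmf_of_set (orientations (h ` e)) = map_pmf ?\<phi> (pmf_of_set (orientations e))"
    by (simp add: map_pmf_of_set_inj e(2))
  then show ?thesis
    unfolding arc_pmf_def map_bind_pmf
    by (intro bind_pmf_cong refl) (simp add: map_pmf_comp)
qed

lemma edges_on_image:
  assumes "bij h"
  shows "edges_on (h ` V) = image h ` edges_on V"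
proof -
  have "e \<in> image h ` edges_on V" if "e \<in> edges_on (h ` V)" for e
  proof -
    have "e \<subseteq> h ` V" using that by (simp add: edges_on_def)
    then obtain A where A: "A \<subseteq> V" "e = h ` A" by (rule subset_imageE)
    then show ?thesis
      using that assms by (auto simp: edges_on_def card_image bij_is_inj inj_on_subset[of h UNIV])
  qed
  moreover have "h ` e \<in> edges_on (h ` V)" if "e \<in> edges_on V" for e
    using that assms by (auto simp: edges_on_def card_image bij_is_inj inj_on_subset[of h UNIV])
  ultimately show ?thesis by blast
qed

lemma arcs_pmf_relabel:
  assumes "finite V" "bij h"
  shows "arcs_pmf p (edges_on (h ` V)) = map_pmf (image (map_prod h h)) (arcs_pmf p (edges_on V))"
proof -
  let ?\<phi> = "image (map_prod h h)" and ?E = "edges_on V"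
  have fin: "finite ?E" using assms(1) by simp
  have bij: "bij (image h)" by (metis bij_betw_Pow assms(2) Pow_UNIV)
  have "arcs_pmf p (edges_on (h ` V)) =
      map_pmf (\<lambda>f. \<Union>e\<in>?E. f e) (map_pmf (\<lambda>g. g \<circ> image h) (Pi_pmf (image h ` ?E) {} (arc_pmf p)))"
    unfolding arcs_pmf_def edges_on_image[OF assms(2)] map_pmf_comp by simp
  also have "\<dots> = map_pmf (\<lambda>f. \<Union>e\<in>?E. f e) (Pi_pmf ?E {} (\<lambda>e. arc_pmf p (h ` e)))"
    by (subst Pi_pmf_reindex[OF fin bij]) simp
  also have "\<dots> = map_pmf (\<lambda>f. \<Union>e\<in>?E. f e) (Pi_pmf ?E {} (\<lambda>e. map_pmf ?\<phi> (arc_pmf p e)))"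
    using arc_pmf_image[OF _ assms(2)] by (intro arg_cong[where f = "map_pmf _"] Pi_pmf_cong) auto
  also have "\<dots> = map_pmf (\<lambda>f. \<Union>e\<in>?E. f e) (map_pmf (\<lambda>f. ?\<phi> \<circ> f) (Pi_pmf ?E {} (arc_pmf p)))"
    by (subst Pi_pmf_map[OF fin, of ?\<phi> "{}" "{}"]) simp_all
  also have "\<dots> = map_pmf ?\<phi> (arcs_pmf p ?E)"
    by (simp add: arcs_pmf_def map_pmf_comp image_UN)
  finally show ?thesis .
qed

text \<open>Both orientations of an edge are equally likely, so reversing every arc preserves the
  distribution. This exchanges out-clusters and in-clusters.\<close>

lemma arcs_pmf_converse:
  assumes "finite E" "E \<subseteq> edges_on V"
  shows "map_pmf converse (arcs_pmf p E) = arcs_pmf p E"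
proof -
  have arc: "map_pmf converse (arc_pmf p e) = arc_pmf p e" if "e \<in> E" for e
  proof -
    have "e \<in> edges_on V" using that assms(2) by blast
    then obtain u v where e: "orientations e = {(u, v), (v, u)}" by (rule edges_on_cases)
    have "map_pmf prod.swap (pmf_of_set (orientations e)) = pmf_of_set (orientations e)"
      by (subst map_pmf_of_set_inj) (auto simp: e insert_commute)
    then have "map_pmf (\<lambda>a. {a}) (pmf_of_set (orientations e)) =
        map_pmf (\<lambda>a. {prod.swap a}) (pmf_of_set (orientations e))"
      by (metis (no_types, lifting) map_pmf_comp map_pmf_cong)
    moreover have "{prod.swap a} = converse {a}" for a :: "nat \<times> nat" by (cases a) auto
    ultimately show ?thesis
      unfolding arc_pmf_def map_bind_pmf
      by (intro bind_pmf_cong refl) (simp add: map_pmf_comp)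
  qed
  have "arcs_pmf p E = map_pmf (\<lambda>f. \<Union>e\<in>E. f e) (Pi_pmf E {} (\<lambda>e. map_pmf converse (arc_pmf p e)))"
    unfolding arcs_pmf_def using arc by (intro arg_cong[where f = "map_pmf _"] Pi_pmf_cong) auto
  also have "\<dots> = map_pmf (\<lambda>f. \<Union>e\<in>E. f e) (map_pmf (\<lambda>f. converse \<circ> f) (Pi_pmf E {} (arc_pmf p)))"
    by (subst Pi_pmf_map[OF assms(1), of converse "{}" "{}"]) simp_all
  also have "\<dots> = map_pmf converse (arcs_pmf p E)"
    by (simp add: arcs_pmf_def map_pmf_comp converse_UNION)
  finally show ?thesis ..
qed

lemma prob_arcs_pmf_converse:
  assumes "finite E" "E \<subseteq> edges_on V"
  shows "measure_pmf.prob (arcs_pmf p E) {D. P (D\<inverse>)} = measure_pmf.prob (arcs_pmf p E) {D. P D}"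
proof -
  have "measure_pmf.prob (arcs_pmf p E) {D. P D} =
      measure_pmf.prob (map_pmf converse (arcs_pmf p E)) {D. P D}"
    by (simp only: arcs_pmf_converse[OF assms])
  then show ?thesis by (simp add: vimage_def)
qed

lemma clusters_converse:
  "out_cluster (D\<inverse>) s = in_cluster D s" "in_cluster (D\<inverse>) s = out_cluster D s"
  by (auto simp: out_cluster_def in_cluster_def rtrancl_converse)

text \<open>The quantities in question are defined on vertex sets \<open>{1..n}\<close>, whereas deleting vertices leads
  to arbitrary finite vertex sets. This relabelling carries the latter back to the former.\<close>

lemma relabel_to_initial_segment:
  assumes "V \<subseteq> {1..N}"
  obtains \<pi> where "\<pi> permutes {1..N}" "\<pi> ` V = {1..card V}"
proof -
  let ?n = "card V"
  have n: "?n \<le> N" using card_mono[OF _ assms] by simp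
  have "card {x \<in> {1..N}. (x \<in> V) = c} = card {x \<in> {1..N}. (x \<in> {1..?n}) = c}" for c
  proof -
    have sub: "{1..?n} \<subseteq> {1..N}" using n by simp
    have sel: "card {x \<in> {1..N}. (x \<in> A) = c} = (if c then card A else N - card A)"
      if "A \<subseteq> {1..N}" for A
    proof -
      have "{x \<in> {1..N}. (x \<in> A) = c} = (if c then A else {1..N} - A)" using that by auto
      then show ?thesis using that finite_vertices[OF that] by (simp add: card_Diff_subset)
    qed
    show ?thesis unfolding sel[OF assms] sel[OF sub] by simp
  qed
  then obtain \<pi> where \<pi>: "\<pi> permutes {1..N}" "\<forall>x\<in>{1..N}. (x \<in> V) = (\<pi> x \<in> {1..?n})"
    by (rule exists_relabelling)
  have "\<pi> ` V = {1..?n}"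
    by (rule permutes_image_eq[OF \<pi>(1) assms]) (use n \<pi>(2) in auto)
  with \<pi>(1) that show thesis by blast
qed

lemma M_prob_on:
  assumes "V \<subseteq> {1..N}" "s \<in> X" "X \<subseteq> V" "s \<in> Y" "Y \<subseteq> V"
  shows "M_prob p (card V) (card X) (card Y) (card (V - (Y \<union> X))) =
    measure_pmf.prob (arcs_pmf p (edges_on V)) {D. out_cluster D s = X \<and> in_cluster D s = Y}"
proof -
  obtain \<pi> where \<pi>: "\<pi> permutes {1..N}" "\<pi> ` V = {1..card V}"
    using relabel_to_initial_segment[OF assms(1)] .
  have inj: "inj \<pi>" using \<pi>(1) by (rule permutes_inj)
  have card: "card (\<pi> ` A) = card A" for A using inj by (simp add: card_image inj_on_subset)
  have sub: "\<pi> ` A \<subseteq> {1..card V}" if "A \<subseteq> V" for A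
    using image_mono[OF that, of \<pi>] by (simp only: \<pi>(2))
  have "{1..card V} - (\<pi> ` Y \<union> \<pi> ` X) = \<pi> ` (V - (Y \<union> X))"
    unfolding \<pi>(2)[symmetric] by (simp add: image_set_diff[OF inj] image_Un)
  then have "M_prob p (card V) (card X) (card Y) (card (V - (Y \<union> X))) =
      measure_pmf.prob (dgnp (card V) p)
        {D. out_cluster D (\<pi> s) = \<pi> ` X \<and> in_cluster D (\<pi> s) = \<pi> ` Y}"
    using assms(2-5) sub[OF assms(3)] sub[OF assms(5)] by (intro M_prob_eq) (simp_all add: card)
  also have "dgnp (card V) p = map_pmf (image (map_prod \<pi> \<pi>)) (arcs_pmf p (edges_on V))"
    unfolding dgnp_eq_arcs_pmf \<pi>(2)[symmetric]
    by (rule arcs_pmf_relabel[OF finite_vertices[OF assms(1)] permutes_bij[OF \<pi>(1)]])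
  finally show ?thesis
    by (simp add: vimage_def clusters_relabel[OF \<pi>(1)] image_eq_iff[OF \<pi>(1)])
qed

lemma d_prob_on:
  assumes "V \<subseteq> {1..N}" "s \<in> X" "X \<subseteq> V"
  shows "d_prob p (card V) (card X) =
    measure_pmf.prob (arcs_pmf p (edges_on V)) {D. out_cluster D s = X}"
proof -
  obtain \<pi> where \<pi>: "\<pi> permutes {1..N}" "\<pi> ` V = {1..card V}"
    using relabel_to_initial_segment[OF assms(1)] .
  have card: "card (\<pi> ` A) = card A" for A
    using permutes_inj[OF \<pi>(1)] by (simp add: card_image inj_on_subset)
  have "d_prob p (card V) (card X) =
      measure_pmf.prob (dgnp (card V) p) {D. out_cluster D (\<pi> s) = \<pi> ` X}"
    using assms(2) image_mono[OF assms(3), of \<pi>, unfolded \<pi>(2)]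
    by (intro d_prob_eq) (simp_all add: card)
  also have "dgnp (card V) p = map_pmf (image (map_prod \<pi> \<pi>)) (arcs_pmf p (edges_on V))"
    unfolding dgnp_eq_arcs_pmf \<pi>(2)[symmetric]
    by (rule arcs_pmf_relabel[OF finite_vertices[OF assms(1)] permutes_bij[OF \<pi>(1)]])
  finally show ?thesis
    by (simp add: vimage_def clusters_relabel[OF \<pi>(1)] image_eq_iff[OF \<pi>(1)])
qed

section \<open>Deterministic decompositions of the clusters\<close>

lemma rtrancl_within_closed:
  assumes "(s, u) \<in> D\<^sup>*" "s \<in> X" "D `` X \<subseteq> X"
  shows "u \<in> X \<and> (s, u) \<in> (D \<inter> X \<times> X)\<^sup>*"
  using assms(1)
proof (induction rule: rtrancl_induct)
  case (step v u)
  then have "(v, u) \<in> D \<inter> X \<times> X" using assms(3) by blast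
  with step.IH show ?case by (meson IntE SigmaE2 rtrancl.rtrancl_into_rtrancl)
qed (use assms(2) in simp)

lemma rtrancl_within_backward_closed:
  assumes "(u, s) \<in> D\<^sup>*" "s \<in> X" "D\<inverse> `` X \<subseteq> X"
  shows "u \<in> X \<and> (u, s) \<in> (D \<inter> X \<times> X)\<^sup>*"
proof -
  have "u \<in> X \<and> (s, u) \<in> (D\<inverse> \<inter> X \<times> X)\<^sup>*"
    using assms by (intro rtrancl_within_closed) (auto simp: rtrancl_converse)
  moreover have "D\<inverse> \<inter> X \<times> X = (D \<inter> X \<times> X)\<inverse>" by auto
  ultimately show ?thesis by (simp add: rtrancl_converse)
qed

lemma out_cluster_closed: "D `` out_cluster D s \<subseteq> out_cluster D s"
  by (auto simp: out_cluster_def intro: rtrancl_into_rtrancl)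

lemma in_cluster_closed: "D\<inverse> `` in_cluster D s \<subseteq> in_cluster D s"
  by (auto simp: in_cluster_def intro: converse_rtrancl_into_rtrancl)

lemma out_cluster_eqI:
  assumes "s \<in> X" "D `` X \<subseteq> X" "X \<subseteq> out_cluster D s"
  shows "out_cluster D s = X"
  using assms rtrancl_within_closed[of s _ D X] by (auto simp: out_cluster_def)

lemma in_cluster_eqI:
  assumes "s \<in> X" "D\<inverse> `` X \<subseteq> X" "X \<subseteq> in_cluster D s"
  shows "in_cluster D s = X"
  using assms rtrancl_within_backward_closed[of _ s D X] by (auto simp: in_cluster_def)

lemma clusters_mono:
  assumes "D \<subseteq> D'"
  shows "out_cluster D s \<subseteq> out_cluster D' s" "in_cluster D s \<subseteq> in_cluster D' s"
  using rtrancl_mono[OF assms] by (auto simp: out_cluster_def in_cluster_def)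

lemma self_in_cluster: "s \<in> out_cluster D s" "s \<in> in_cluster D s"
  by (auto simp: out_cluster_def in_cluster_def)

text \<open>A directed path that starts in \<open>s\<close> never leaves the out-cluster, so whether the out-cluster
  equals \<open>X\<close> can be read off from the subgraph on any \<open>U \<supseteq> X\<close>, provided that no arc leads from \<open>X\<close> out
  of \<open>U\<close>.\<close>

lemma out_cluster_restrict_eq_iff:
  assumes "D \<subseteq> V \<times> V" "s \<in> X" "X \<subseteq> U" "U \<subseteq> V"
  shows "out_cluster D s = X \<longleftrightarrow> out_cluster (D \<inter> U \<times> U) s = X \<and> D \<inter> X \<times> (V - U) = {}"
proof
  assume L: "out_cluster D s = X"
  have cl: "D `` X \<subseteq> X" using out_cluster_closed[of D s] L by simp
  have "X \<subseteq> out_cluster (D \<inter> U \<times> U) s"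
  proof
    fix u assume "u \<in> X"
    then have "(s, u) \<in> D\<^sup>*" using L by (auto simp: out_cluster_def)
    then have "(s, u) \<in> (D \<inter> X \<times> X)\<^sup>*" using rtrancl_within_closed[OF _ assms(2) cl] by blast
    moreover have "D \<inter> X \<times> X \<subseteq> D \<inter> U \<times> U" using assms(3) by auto
    ultimately show "u \<in> out_cluster (D \<inter> U \<times> U) s"
      unfolding out_cluster_def using rtrancl_mono by blast
  qed
  then have "out_cluster (D \<inter> U \<times> U) s = X"
    using cl assms(2) by (intro out_cluster_eqI) auto
  moreover have "D \<inter> X \<times> (V - U) = {}" using cl assms(3) by auto
  ultimately show "out_cluster (D \<inter> U \<times> U) s = X \<and> D \<inter> X \<times> (V - U) = {}" ..
next
  assume R: "out_cluster (D \<inter> U \<times> U) s = X \<and> D \<inter> X \<times> (V - U) = {}"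
  have "(D \<inter> U \<times> U) `` X \<subseteq> X" using out_cluster_closed[of "D \<inter> U \<times> U" s] R by simp
  then have "D `` X \<subseteq> X" using R assms(1,3) by blast
  moreover have "X \<subseteq> out_cluster D s" using R clusters_mono(1)[of "D \<inter> U \<times> U" D s] by auto
  ultimately show "out_cluster D s = X" using assms(2) by (intro out_cluster_eqI)
qed

lemma in_cluster_restrict_eq_iff:
  assumes "D \<subseteq> V \<times> V" "s \<in> Y" "Y \<subseteq> U" "U \<subseteq> V"
  shows "in_cluster D s = Y \<longleftrightarrow> in_cluster (D \<inter> U \<times> U) s = Y \<and> D \<inter> (V - U) \<times> Y = {}"
proof -
  have "(D \<inter> U \<times> U)\<inverse> = D\<inverse> \<inter> U \<times> U" "D \<inter> (V - U) \<times> Y = {} \<longleftrightarrow> D\<inverse> \<inter> Y \<times> (V - U) = {}"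
    by auto
  moreover have "D\<inverse> \<subseteq> V \<times> V" using assms(1) by auto
  ultimately show ?thesis
    using out_cluster_restrict_eq_iff[of "D\<inverse>" V s Y U] assms(2-4)
    by (metis clusters_converse(1))
qed

text \<open>Here \<open>w\<close> lies in the in-cluster \<open>Y\<close> but outside the out-cluster \<open>X\<close>, and \<open>J\<close> collects the vertices
  outside \<open>X\<close> all of whose paths to \<open>s\<close> pass through the gateway \<open>w\<close>. Fixing \<open>J\<close> makes the event split
  into conditions on disjoint sets of vertex pairs. Outside \<open>J\<close> the clusters of \<open>s\<close> are \<open>X\<close> and
  \<open>Y - J\<close>; inside \<open>J\<close> every vertex reaches \<open>w\<close>; between the two parts no arc leads from \<open>X\<close> into
  \<open>J\<close>, none leads from \<open>J - {w}\<close> directly to a vertex of \<open>Y - J\<close>, as it would bypass \<open>w\<close>, and at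
  least one arc leads from \<open>w\<close> to \<open>Y - J\<close>.\<close>

lemma gateway_decomposition:
  fixes D :: "nat rel"
  assumes "D \<subseteq> V \<times> V" "s \<in> X" "s \<in> Y" "X \<union> Y = V" "w \<in> J" "J \<subseteq> V - X"
  defines "T \<equiv> in_cluster (D \<inter> (V - {w}) \<times> (V - {w})) s"
    and "R \<equiv> D \<inter> (V - J) \<times> (V - J)"
  shows "out_cluster D s = X \<and> in_cluster D s = Y \<and> J = V - X - T \<longleftrightarrow>
    (out_cluster R s = X \<and> in_cluster R s = Y - J) \<and>
    in_cluster (D \<inter> J \<times> J) w = J \<and>
    D \<inter> (X \<times> J \<union> (J - {w}) \<times> (Y - J)) = {} \<and> D \<inter> {w} \<times> (Y - J) \<noteq> {}"
    (is "?L \<longleftrightarrow> (?R1 \<and> ?R2) \<and> ?R3 \<and> ?R4 \<and> ?R5")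
proof -
  let ?Dw = "D \<inter> (V - {w}) \<times> (V - {w})"
  have s: "s \<in> V - J" "s \<noteq> w" and JY: "J \<subseteq> Y" and w: "w \<in> V" "w \<notin> X"
    using assms(2-6) by auto
  have JV: "V - (V - J) = J" "V - J \<subseteq> V" "X \<subseteq> V - J" using assms(4,6) by auto
  have out_iff: "out_cluster D s = X \<longleftrightarrow> ?R1 \<and> D \<inter> X \<times> J = {}"
    using out_cluster_restrict_eq_iff[OF assms(1,2) JV(3,2)] unfolding R_def JV(1) .
  have RDw: "R \<subseteq> ?Dw" unfolding R_def using assms(5) by auto
  have Tcl: "?Dw\<inverse> `` T \<subseteq> T" unfolding T_def by (rule in_cluster_closed)
  \<comment> \<open>A path from \<open>a \<in> J\<close> to \<open>s\<close> has to leave \<open>J\<close>, and the forbidden arcs let it do so only at \<open>w\<close>.\<close>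
  have enter_from_J: "(a, w) \<in> (D \<inter> J \<times> J)\<^sup>* \<and> (\<exists>v. (w, v) \<in> D \<and> v \<in> Y - J)"
    if "in_cluster D s = Y" "?R4" "a \<in> J" for a
  proof -
    have "(a, s) \<in> D\<^sup>*" using that(1,3) JY by (auto simp: in_cluster_def)
    then show ?thesis using that(3)
    proof (induction rule: converse_rtrancl_induct)
      case base
      then show ?case using s by simp
    next
      case (step a v)
      have v: "v \<in> Y" using step.hyps(2) that(1) by (auto simp: in_cluster_def)
      show ?case
      proof (cases "v \<in> J")
        case True
        have "(a, v) \<in> D \<inter> J \<times> J" using step True by auto
        with step.IH[OF True] show ?thesis by (meson converse_rtrancl_into_rtrancl)
      next
        case False
        then have "a = w" using step v that(2) by blast
        then show ?thesis using step.hyps(1) v False by auto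
      qed
    qed
  qed
  show ?thesis
  proof
    assume L: ?L
    then have out: "out_cluster D s = X" and inY: "in_cluster D s = Y" and J: "J = V - X - T" by auto
    have R1: "?R1" and XJ: "D \<inter> X \<times> J = {}" using out out_iff by auto
    have Xcl: "D `` X \<subseteq> X" using out_cluster_closed[of D s] out by simp
    have "Y - J \<subseteq> in_cluster R s"
    proof
      fix u assume u: "u \<in> Y - J"
      have uT: "u \<in> T"
      proof (cases "u \<in> X")
        case True
        have "(u, s) \<in> D\<^sup>*" using u inY by (auto simp: in_cluster_def)
        then have "(u, s) \<in> (D \<inter> X \<times> X)\<^sup>*" using rtrancl_within_closed[OF _ True Xcl] by blast
        moreover have "D \<inter> X \<times> X \<subseteq> ?Dw" using assms(4) w by auto
        ultimately show ?thesis unfolding T_def in_cluster_def using rtrancl_mono by blast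
      next
        case False
        then show ?thesis using u J assms(4) by auto
      qed
      have "(u, s) \<in> (D \<inter> (V - J) \<times> (V - J))\<^sup>*"
      proof -
        have "(u, s) \<in> ?Dw\<^sup>*" using uT by (simp add: T_def in_cluster_def)
        moreover have "s \<in> T" unfolding T_def by (rule self_in_cluster)
        ultimately have "(u, s) \<in> (?Dw \<inter> T \<times> T)\<^sup>*"
          using rtrancl_within_backward_closed[OF _ _ Tcl] by blast
        moreover have "?Dw \<inter> T \<times> T \<subseteq> D \<inter> (V - J) \<times> (V - J)" using J by auto
        ultimately show ?thesis using rtrancl_mono by blast
      qed
      then show "u \<in> in_cluster R s" by (simp add: in_cluster_def R_def)
    qed
    moreover have "in_cluster R s \<subseteq> Y - J"
    proof -
      have "in_cluster R s \<subseteq> Y" using clusters_mono(2)[of R D s] inY by (auto simp: R_def)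
      moreover have "in_cluster R s \<subseteq> V - J"
        using s by (auto simp: in_cluster_def R_def elim: converse_rtranclE)
      ultimately show ?thesis by blast
    qed
    ultimately have R2: ?R2 by blast
    have "D \<inter> (J - {w}) \<times> (Y - J) = {}"
    proof -
      have False if "(u, v) \<in> D" "u \<in> J" "u \<noteq> w" "v \<in> Y - J" for u v
      proof -
        have "v \<in> T"
          using that(4) R2 RDw unfolding T_def using clusters_mono(2) by blast
        moreover have "v \<noteq> w" using that(4) assms(5) by auto
        ultimately have "u \<in> T" using Tcl that assms(1) by blast
        with that(2) J show False by blast
      qed
      then show ?thesis by auto
    qed
    with XJ have R4: ?R4 by auto
    have "in_cluster (D \<inter> J \<times> J) w = J"
      using enter_from_J[OF inY R4] assms(5) by (intro in_cluster_eqI) (auto simp: in_cluster_def)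
    moreover have ?R5 using enter_from_J[OF inY R4 assms(5)] by auto
    ultimately show "(?R1 \<and> ?R2) \<and> ?R3 \<and> ?R4 \<and> ?R5" using R1 R2 R4 by blast
  next
    assume R: "(?R1 \<and> ?R2) \<and> ?R3 \<and> ?R4 \<and> ?R5"
    then have out: "out_cluster D s = X" using out_iff by auto
    have RY: "Y - J \<subseteq> in_cluster D s" using R clusters_mono(2)[of R D s] by (auto simp: R_def)
    obtain v where v: "(w, v) \<in> D" "v \<in> Y - J" using R by auto
    have "J \<subseteq> in_cluster D s"
    proof
      fix u assume "u \<in> J"
      then have "(u, w) \<in> (D \<inter> J \<times> J)\<^sup>*" using R by (auto simp: in_cluster_def)
      then have "(u, w) \<in> D\<^sup>*" using rtrancl_mono[of "D \<inter> J \<times> J" D] by blast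
      moreover have "(v, s) \<in> D\<^sup>*" using RY v by (auto simp: in_cluster_def)
      ultimately show "u \<in> in_cluster D s" using v(1) by (simp add: in_cluster_def)
    qed
    with RY have Ysub: "Y \<subseteq> in_cluster D s" by blast
    have Rcl: "R\<inverse> `` (Y - J) \<subseteq> Y - J" using in_cluster_closed[of R s] R by simp
    have "D\<inverse> `` Y \<subseteq> Y"
    proof -
      have "u \<in> Y" if "(u, v) \<in> D" "v \<in> Y" for u v
      proof (rule ccontr)
        assume u: "u \<notin> Y"
        then have uX: "u \<in> X" "u \<in> V - J" using that(1) assms(1,4) JY by auto
        have "v \<notin> J" using R uX(1) that(1) by auto
        then have "(u, v) \<in> R" using uX that assms(1) by (auto simp: R_def)
        then show False using Rcl that(2) \<open>v \<notin> J\<close> u by blast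
      qed
      then show ?thesis by auto
    qed
    then have inY: "in_cluster D s = Y" using assms(3) Ysub by (intro in_cluster_eqI)
    have "u \<notin> J" if "u \<in> T" for u
    proof -
      have "(u, s) \<in> ?Dw\<^sup>*" using that by (simp add: T_def in_cluster_def)
      then show ?thesis
      proof (induction rule: converse_rtrancl_induct)
        case base
        then show ?case using s by simp
      next
        case (step a b)
        have "(b, s) \<in> D\<^sup>*" using step.hyps(2) rtrancl_mono[of ?Dw D] by blast
        then have "b \<in> Y" using inY by (auto simp: in_cluster_def)
        then show ?case using step R by blast
      qed
    qed
    moreover have "u \<in> T" if "u \<in> V - X - J" for u
    proof -
      have "u \<in> in_cluster R s" using that R assms(4) by blast
      then show ?thesis unfolding T_def using clusters_mono(2)[OF RDw] by blast
    qed
    ultimately have "J = V - X - T" using assms(6) by blast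
    with out inY show ?L by blast
  qed
qed

section \<open>Factorisation of the cluster probabilities\<close>

lemma Int_arcs_of_edges_on:
  assumes "D \<subseteq> arcs_of (edges_on V)"
  shows "D \<inter> arcs_of (edges_on U) = D \<inter> U \<times> U"
  using assms by (auto simp: arcs_of_edges_on)

lemma arcs_of_Diff: "arcs_of (E - E') = arcs_of E - arcs_of E'"
  by (auto simp: arcs_of_iff)

text \<open>A vertex outside \<open>X \<union> Y\<close> receives no arc from \<open>X\<close> and sends none to \<open>Y\<close>. Hence it has no edge to
  \<open>X \<inter> Y\<close> and misses one orientation towards every other vertex of \<open>X \<union> Y\<close>; all other pairs that
  involve it are unconstrained.\<close>

lemma prob_clusters_restrict:
  assumes "0 \<le> p" "p \<le> 1" "finite V" "s \<in> X" "s \<in> Y" "X \<union> Y \<subseteq> V"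
  defines "U \<equiv> X \<union> Y"
  shows "measure_pmf.prob (arcs_pmf p (edges_on V)) {D. out_cluster D s = X \<and> in_cluster D s = Y} =
    measure_pmf.prob (arcs_pmf p (edges_on U)) {D. out_cluster D s = X \<and> in_cluster D s = Y} *
    (1 - p) ^ (card (V - U) * card (X \<inter> Y)) *
    (1 - p / 2) ^ (card (V - U) * (card (X - Y) + card (Y - X)))"
proof -
  define Z where "Z = V - U"
  define E2 where "E2 = edges_on V - edges_on U"
  define F where "F = X \<times> Z \<union> Z \<times> Y"
  define S where "S = (X - Y) \<times> Z \<union> Z \<times> (Y - X)"
  define B where "B = (X \<inter> Y) \<times> Z"
  have UV: "U \<subseteq> V" and disj: "X \<inter> Z = {}" "Y \<inter> Z = {}" using assms(6) by (auto simp: U_def Z_def)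
  have XYU: "X \<subseteq> U" "Y \<subseteq> U" by (auto simp: U_def)
  have fin: "finite X" "finite Y" "finite Z"
    using assms(3,6) by (auto simp: Z_def intro: finite_subset)
  have FE: "F \<subseteq> arcs_of E2"
    using assms(6) by (auto simp: F_def Z_def E2_def U_def arcs_of_Diff arcs_of_edges_on)
  have "measure_pmf.prob (arcs_pmf p (edges_on V)) {D. out_cluster D s = X \<and> in_cluster D s = Y} =
      measure_pmf.prob (arcs_pmf p (edges_on U)) {D. out_cluster D s = X \<and> in_cluster D s = Y} *
      measure_pmf.prob (arcs_pmf p E2) {D. D \<inter> F = {}}"
  proof (rule prob_arcs_pmf_Un[OF subset_refl])
    show "edges_on V = edges_on U \<union> E2" using edges_on_mono[OF UV] by (auto simp: E2_def)
    fix D assume D: "D \<subseteq> arcs_of (edges_on V)"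
    then have DV: "D \<subseteq> V \<times> V" by (auto simp: arcs_of_edges_on)
    have "D \<inter> arcs_of E2 \<inter> F = D \<inter> F" using FE by blast
    moreover have "D \<inter> F = {} \<longleftrightarrow> D \<inter> X \<times> (V - U) = {} \<and> D \<inter> (V - U) \<times> Y = {}"
      by (auto simp: F_def Z_def)
    ultimately show "out_cluster D s = X \<and> in_cluster D s = Y \<longleftrightarrow>
      (out_cluster (D \<inter> arcs_of (edges_on U)) s = X \<and> in_cluster (D \<inter> arcs_of (edges_on U)) s = Y) \<and>
      D \<inter> arcs_of E2 \<inter> F = {}"
      unfolding Int_arcs_of_edges_on[OF D]
        out_cluster_restrict_eq_iff[OF DV assms(4) XYU(1) UV]
        in_cluster_restrict_eq_iff[OF DV assms(5) XYU(2) UV]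
      by blast
  qed (use assms(3) in \<open>auto simp: E2_def\<close>)
  also have "measure_pmf.prob (arcs_pmf p E2) {D. D \<inter> F = {}} = (1 - p / 2) ^ card S * (1 - p) ^ card B"
  proof (rule prob_arcs_avoid[OF assms(1,2,3)])
    show "S \<subseteq> arcs_of E2" "B \<subseteq> arcs_of E2" using FE by (auto simp: S_def B_def F_def)
  qed (use disj in \<open>auto simp: E2_def S_def B_def F_def\<close>)
  also have "card S = card Z * (card (X - Y) + card (Y - X))"
    unfolding S_def using fin disj
    by (subst card_Un_disjoint) (auto simp: card_cartesian_product algebra_simps)
  also have "card B = card Z * card (X \<inter> Y)"
    by (simp add: B_def card_cartesian_product)
  finally show ?thesis by (simp add: Z_def)
qed

text \<open>The three parts of the gateway decomposition concern the pairs within \<open>V - J\<close>, the pairs within \<open>J\<close>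
  and the pairs between them, hence the product. The last factor is the probability of avoiding
  the forbidden arcs, minus that of avoiding them together with all arcs from \<open>w\<close> to \<open>Y - J\<close>.\<close>

lemma prob_gateway:
  assumes "0 \<le> p" "p \<le> 1" "finite V" "s \<in> X" "s \<in> Y" "X \<union> Y = V" "w \<in> J" "J \<subseteq> V - X"
  shows "measure_pmf.prob (arcs_pmf p (edges_on V)) {D. out_cluster D s = X \<and> in_cluster D s = Y \<and>
      J = V - X - in_cluster (D \<inter> (V - {w}) \<times> (V - {w})) s} =
    measure_pmf.prob (arcs_pmf p (edges_on (V - J))) {D. out_cluster D s = X \<and> in_cluster D s = Y - J} *
    (measure_pmf.prob (arcs_pmf p (edges_on J)) {D. in_cluster D w = J} *
     ((1 - p / 2) ^ (card (X - Y) * card J + card (X \<inter> Y) + (card J - 1) * card (V - X - J)) *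
        (1 - p) ^ (card (X \<inter> Y) * (card J - 1)) -
      (1 - p / 2) ^ (card (X - Y) * card J + card J * card (V - X - J)) *
        (1 - p) ^ (card (X \<inter> Y) * card J)))"
proof -
  define F1 where "F1 = X \<times> J \<union> (J - {w}) \<times> (Y - J)"
  define F2 where "F2 = {w} \<times> (Y - J)"
  define E' where "E' = edges_on V - edges_on (V - J)"
  define E'' where "E'' = E' - edges_on J"
  define K where "K = V - X - J"
  have fin: "finite X" "finite Y" "finite J" "finite K"
    using assms(3,6,8) by (auto simp: K_def intro: finite_subset)
  have disj: "X \<inter> J = {}" "K \<inter> J = {}" "X \<inter> K = {}" and JY: "J \<subseteq> Y"
    and YJ: "Y - J = (X \<inter> Y) \<union> K"
    using assms(6,8) by (auto simp: K_def)
  have EJ: "edges_on J \<subseteq> E'"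
  proof
    fix e assume e: "e \<in> edges_on J"
    then obtain u v where uv: "e = {u, v}" "u \<in> J" by (rule edges_on_cases)
    then show "e \<in> E'" using e assms(8) by (auto simp: E'_def edges_on_def)
  qed
  have arcsE'': "arcs_of E'' = V \<times> V - (V - J) \<times> (V - J) - J \<times> J"
    using assms(8) by (auto simp: E''_def E'_def arcs_of_Diff arcs_of_edges_on)
  have FE: "F1 \<union> F2 \<subseteq> arcs_of E''"
    unfolding arcsE'' using assms(6-8) by (auto simp: F1_def F2_def)
  have E''V: "E'' \<subseteq> edges_on V" by (auto simp: E''_def E'_def)
  have finE: "finite (edges_on V)" "finite E'" "finite E''"
    using assms(3) by (auto simp: E'_def E''_def)
  let ?Q = "\<lambda>D. D \<inter> F1 = {} \<and> D \<inter> F2 \<noteq> {}"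
  let ?P = "\<lambda>D. in_cluster (D \<inter> J \<times> J) w = J \<and> ?Q D"
  have "measure_pmf.prob (arcs_pmf p (edges_on V)) {D. out_cluster D s = X \<and> in_cluster D s = Y \<and>
      J = V - X - in_cluster (D \<inter> (V - {w}) \<times> (V - {w})) s} =
    measure_pmf.prob (arcs_pmf p (edges_on (V - J))) {D. out_cluster D s = X \<and> in_cluster D s = Y - J} *
    measure_pmf.prob (arcs_pmf p E') {D. ?P D}"
  proof (rule prob_arcs_pmf_Un[OF subset_refl finE(1)])
    show "edges_on V = edges_on (V - J) \<union> E'"
      using edges_on_mono[of "V - J" V] by (auto simp: E'_def)
    fix D assume D: "D \<subseteq> arcs_of (edges_on V)"
    then have DV: "D \<subseteq> V \<times> V" by (auto simp: arcs_of_edges_on)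
    have "arcs_of E'' \<subseteq> arcs_of E'" "arcs_of (edges_on J) \<subseteq> arcs_of E'"
      using EJ by (auto simp: E''_def arcs_of_Diff intro!: arcs_of_mono)
    then have "D \<inter> arcs_of E' \<inter> J \<times> J = D \<inter> J \<times> J" "D \<inter> arcs_of E' \<inter> F1 = D \<inter> F1"
      "D \<inter> arcs_of E' \<inter> F2 = D \<inter> F2"
      using FE D by (auto simp: arcs_of_edges_on)
    then show "(out_cluster D s = X \<and> in_cluster D s = Y \<and>
        J = V - X - in_cluster (D \<inter> (V - {w}) \<times> (V - {w})) s) =
      ((out_cluster (D \<inter> arcs_of (edges_on (V - J))) s = X \<and>
        in_cluster (D \<inter> arcs_of (edges_on (V - J))) s = Y - J) \<and> ?P (D \<inter> arcs_of E'))"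
      unfolding Int_arcs_of_edges_on[OF D] gateway_decomposition[OF DV assms(4-8)]
      by (simp only: F1_def F2_def)
  qed (auto simp: E'_def)
  also have "measure_pmf.prob (arcs_pmf p E') {D. ?P D} =
      measure_pmf.prob (arcs_pmf p (edges_on J)) {D. in_cluster D w = J} *
      measure_pmf.prob (arcs_pmf p E'') {D. ?Q D}"
  proof (rule prob_arcs_pmf_Un[OF _ finE(2)])
    show "E' \<subseteq> edges_on V" by (auto simp: E'_def)
    show "E' = edges_on J \<union> E''" using EJ by (auto simp: E''_def)
    fix D assume D: "D \<subseteq> arcs_of E'"
    then have "D \<subseteq> arcs_of (edges_on V)" by (auto simp: E'_def arcs_of_Diff)
    moreover have "D \<inter> arcs_of E'' \<inter> F1 = D \<inter> F1" "D \<inter> arcs_of E'' \<inter> F2 = D \<inter> F2"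
      using FE by auto
    ultimately show "?P D = (in_cluster (D \<inter> arcs_of (edges_on J)) w = J \<and> ?Q (D \<inter> arcs_of E''))"
      by (simp add: Int_arcs_of_edges_on)
  qed (auto simp: E''_def)
  also have "measure_pmf.prob (arcs_pmf p E'') {D. ?Q D} =
      measure_pmf.prob (arcs_pmf p E'') {D. D \<inter> F1 = {}} -
      measure_pmf.prob (arcs_pmf p E'') {D. D \<inter> (F1 \<union> F2) = {}}"
  proof -
    have "{D. ?Q D} = {D. D \<inter> F1 = {}} - {D. D \<inter> (F1 \<union> F2) = {}}" by auto
    then show ?thesis by (simp add: measure_pmf.finite_measure_Diff Int_Un_distrib Collect_mono_iff)
  qed
  also have "measure_pmf.prob (arcs_pmf p E'') {D. D \<inter> F1 = {}} =
     (1 - p / 2) ^ card ((X - Y) \<times> J \<union> (X \<inter> Y) \<times> {w} \<union> (J - {w}) \<times> K) *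
     (1 - p) ^ card ((X \<inter> Y) \<times> (J - {w}))"
  proof (rule prob_arcs_avoid[OF assms(1,2,3) E''V])
    show "F1 = (X - Y) \<times> J \<union> (X \<inter> Y) \<times> {w} \<union> (J - {w}) \<times> K \<union> (X \<inter> Y) \<times> (J - {w}) \<union>
        ((X \<inter> Y) \<times> (J - {w}))\<inverse>"
      unfolding F1_def YJ using assms(7) by auto
    then show "(X - Y) \<times> J \<union> (X \<inter> Y) \<times> {w} \<union> (J - {w}) \<times> K \<subseteq> arcs_of E''"
      "(X \<inter> Y) \<times> (J - {w}) \<subseteq> arcs_of E''" using FE by auto
  qed (use disj assms(7) in auto)
  also have "measure_pmf.prob (arcs_pmf p E'') {D. D \<inter> (F1 \<union> F2) = {}} =
     (1 - p / 2) ^ card ((X - Y) \<times> J \<union> J \<times> K) * (1 - p) ^ card ((X \<inter> Y) \<times> J)"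
  proof (rule prob_arcs_avoid[OF assms(1,2,3) E''V])
    show "F1 \<union> F2 = (X - Y) \<times> J \<union> J \<times> K \<union> (X \<inter> Y) \<times> J \<union> ((X \<inter> Y) \<times> J)\<inverse>"
      unfolding F1_def F2_def YJ using assms(7) by auto
    then show "(X - Y) \<times> J \<union> J \<times> K \<subseteq> arcs_of E''" "(X \<inter> Y) \<times> J \<subseteq> arcs_of E''"
      using FE by auto
  qed (use disj in auto)
  also have "card ((X - Y) \<times> J \<union> (X \<inter> Y) \<times> {w} \<union> (J - {w}) \<times> K) =
      card (X - Y) * card J + card (X \<inter> Y) + (card J - 1) * card K"
    using fin disj assms(7)
    by (subst card_Un_disjoint; (subst card_Un_disjoint)?) (auto simp: card_cartesian_product)
  also have "card ((X - Y) \<times> J \<union> J \<times> K) = card (X - Y) * card J + card J * card K"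
    using fin disj by (subst card_Un_disjoint) (auto simp: card_cartesian_product)
  finally show ?thesis using assms(7) fin by (simp add: card_cartesian_product K_def)
qed

section \<open>Summing over vertex sets of given sizes\<close>

lemma prob_partition:
  assumes "finite I" "\<And>D. D \<in> set_pmf M \<Longrightarrow> P D \<Longrightarrow> f D \<in> I"
  shows "measure_pmf.prob M {D. P D} = (\<Sum>i\<in>I. measure_pmf.prob M {D. P D \<and> f D = i})"
proof -
  have "measure_pmf.prob M {D. P D} = measure_pmf.prob M (\<Union>i\<in>I. {D. P D \<and> f D = i})"
    by (rule measure_prob_cong_0) (use assms(2) in \<open>auto simp: pmf_eq_0_set_pmf\<close>)
  also have "\<dots> = (\<Sum>i\<in>I. measure_pmf.prob M {D. P D \<and> f D = i})"
    by (rule measure_pmf.finite_measure_finite_Union) (use assms(1) in \<open>auto simp: disjoint_family_on_def\<close>)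
  finally show ?thesis .
qed

lemma sum_over_supersets:
  fixes f :: "nat \<Rightarrow> real"
  assumes "finite V" "J \<subseteq> V"
  shows "(\<Sum>X | J \<subseteq> X \<and> X \<subseteq> V. f (card X)) =
    (\<Sum>k = card J..card V. real ((card V - card J) choose (k - card J)) * f k)"
proof -
  let ?S = "{X. J \<subseteq> X \<and> X \<subseteq> V}"
  have fin: "finite ?S" using assms(1) by (auto intro: finite_subset[of _ "Pow V"])
  have finJ: "finite J" using assms finite_subset by blast
  have count: "card {X \<in> ?S. card X = k} = (card V - card J) choose (k - card J)"
    if "k \<in> {card J..card V}" for k
  proof -
    let ?A = "{A. A \<subseteq> V - J \<and> card A = k - card J}"
    have "{X \<in> ?S. card X = k} = (\<lambda>A. J \<union> A) ` ?A"
    proof (intro equalityI subsetI)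
      fix X assume X: "X \<in> {X \<in> ?S. card X = k}"
      then have "X - J \<in> ?A" "X = J \<union> (X - J)" using finJ by (auto simp: card_Diff_subset)
      then show "X \<in> (\<lambda>A. J \<union> A) ` ?A" by blast
    next
      fix X assume "X \<in> (\<lambda>A. J \<union> A) ` ?A"
      then obtain A where A: "X = J \<union> A" "A \<subseteq> V - J" "card A = k - card J" by auto
      then have "finite A" "J \<inter> A = {}" using assms(1) finite_subset[of A V] by auto
      then have "card X = card J + card A"
        unfolding A(1) using finJ by (intro card_Un_disjoint)
      then show "X \<in> {X \<in> ?S. card X = k}" using A that assms(2) by auto
    qed
    moreover have "inj_on (\<lambda>A. J \<union> A) ?A" by (auto simp: inj_on_def)
    ultimately have "card {X \<in> ?S. card X = k} = card ?A" by (simp add: card_image)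
    also have "\<dots> = (card V - card J) choose (k - card J)"
      using assms finJ by (simp add: n_subsets card_Diff_subset)
    finally show ?thesis .
  qed
  have "(\<Sum>X\<in>?S. f (card X)) = (\<Sum>k\<in>{card J..card V}. \<Sum>X\<in>{X \<in> ?S. card X = k}. f (card X))"
    using assms(1) fin card_mono[OF finite_subset[OF _ assms(1)], of _ J]
    by (intro sum.group[symmetric]) (auto intro: card_mono)
  also have "\<dots> = (\<Sum>k\<in>{card J..card V}. real (card {X \<in> ?S. card X = k}) * f k)"
    by (intro sum.cong refl) simp
  also have "\<dots> = (\<Sum>k = card J..card V. real ((card V - card J) choose (k - card J)) * f k)"
    using count by (intro sum.cong refl) simp
  finally show ?thesis by simp
qed

definition cluster_pairs :: "nat set \<Rightarrow> nat \<Rightarrow> (nat set \<times> nat set) set" where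
  "cluster_pairs V s = {(X, Y). s \<in> X \<and> X \<subseteq> V \<and> s \<in> Y \<and> Y \<subseteq> V}"

lemma finite_cluster_pairs: "finite V \<Longrightarrow> finite (cluster_pairs V s)"
  by (rule finite_subset[of _ "Pow V \<times> Pow V"]) (auto simp: cluster_pairs_def)

text \<open>A pair \<open>(X, Y)\<close> is built by choosing first \<open>J = X \<inter> Y\<close>, then \<open>X\<close> between \<open>J\<close> and \<open>V\<close>, and then \<open>Y\<close>
  between \<open>J\<close> and the complement of \<open>X - J\<close>.\<close>

lemma sum_cluster_pairs:
  fixes f :: "nat \<Rightarrow> nat \<Rightarrow> nat \<Rightarrow> real"
  assumes "finite V" "s \<in> V" "n = card V"
  shows "(\<Sum>(X, Y)\<in>cluster_pairs V s. f (card (X \<inter> Y)) (card X) (card Y)) =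
    (\<Sum>j = 1..n. real ((n - 1) choose (j - 1)) * (\<Sum>k = j..n. real ((n - j) choose (k - j)) *
      (\<Sum>m = j..n - k + j. real ((n - k) choose (m - j)) * f j k m)))"
proof -
  let ?\<J> = "{J. {s} \<subseteq> J \<and> J \<subseteq> V}"
  let ?\<X> = "\<lambda>J. {X. J \<subseteq> X \<and> X \<subseteq> V}"
  let ?\<Y> = "\<lambda>J X. {Y. J \<subseteq> Y \<and> Y \<subseteq> V - (X - J)}"
  have fin: "finite ?\<J>" "finite (?\<X> J)" "finite (?\<Y> J X)" for J X
    using assms(1) by (auto intro: finite_subset[of _ "Pow V"])
  have "(\<Sum>(X, Y)\<in>cluster_pairs V s. f (card (X \<inter> Y)) (card X) (card Y)) =
      (\<Sum>(J, X, Y)\<in>(SIGMA J:?\<J>. SIGMA X:?\<X> J. ?\<Y> J X). f (card J) (card X) (card Y))"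
    by (rule sum.reindex_bij_witness[of _ "\<lambda>(J, X, Y). (X, Y)" "\<lambda>(X, Y). (X \<inter> Y, X, Y)"])
      (auto simp: cluster_pairs_def)
  also have "\<dots> = (\<Sum>J\<in>?\<J>. \<Sum>X\<in>?\<X> J. \<Sum>Y\<in>?\<Y> J X. f (card J) (card X) (card Y))"
    using fin by (simp add: sum.Sigma)
  also have "\<dots> = (\<Sum>J\<in>?\<J>. \<Sum>X\<in>?\<X> J. \<Sum>m = card J..n - card X + card J.
      real ((n - card X) choose (m - card J)) * f (card J) (card X) m)"
  proof (intro sum.cong refl)
    fix J X assume JX: "J \<in> ?\<J>" "X \<in> ?\<X> J"
    have fJX: "finite J" "finite X" using JX assms(1) finite_subset by blast+
    have "card (V - (X - J)) = n - (card X - card J)"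
      using JX fJX by (simp add: card_Diff_subset assms(3) subset_trans[OF Diff_subset])
    moreover have "card X \<le> n" "card J \<le> card X"
      using JX fJX assms(1,3) by (auto intro: card_mono)
    ultimately have c: "card (V - (X - J)) = n - card X + card J" by simp
    show "(\<Sum>Y\<in>?\<Y> J X. f (card J) (card X) (card Y)) =
      (\<Sum>m = card J..n - card X + card J. real ((n - card X) choose (m - card J)) * f (card J) (card X) m)"
      using sum_over_supersets[of "V - (X - J)" J "f (card J) (card X)"] JX assms(1)
      by (simp add: c subset_eq)
  qed
  also have "\<dots> = (\<Sum>J\<in>?\<J>. \<Sum>k = card J..n. real ((n - card J) choose (k - card J)) *
      (\<Sum>m = card J..n - k + card J. real ((n - k) choose (m - card J)) * f (card J) k m))"
    unfolding assms(3)
    by (intro sum.cong refl sum_over_supersets[OF assms(1), where f = "\<lambda>k. \<Sum>m = _..card V - k + _. real ((card V - k) choose (m - _)) * f _ k m"]) auto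
  also have "\<dots> = (\<Sum>j = 1..n. real ((n - 1) choose (j - 1)) * (\<Sum>k = j..n. real ((n - j) choose (k - j)) *
      (\<Sum>m = j..n - k + j. real ((n - k) choose (m - j)) * f j k m)))"
    using sum_over_supersets[OF assms(1), of "{s}" "\<lambda>j. \<Sum>k = j..n. real ((n - j) choose (k - j)) *
      (\<Sum>m = j..n - k + j. real ((n - k) choose (m - j)) * f j k m)"] assms(2,3)
    by simp
  finally show ?thesis .
qed

section \<open>Identities for the cluster probabilities\<close>

lemma M_prob_swap:
  assumes "1 \<le> k" "1 \<le> m" "k \<le> n - r" "m \<le> n - r" "n - r < k + m"
  shows "M_prob p n k m r = M_prob p n m k r"
proof -
  \<comment> \<open>Since \<open>n - r < k + m\<close>, these two intervals cover \<open>{1..n - r}\<close> and share the vertex \<open>k\<close>, which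
    serves as \<open>s\<close>.\<close>
  define X where "X = {1..k}"
  define Y where "Y = {n - r - m + 1..n - r}"
  have sets: "k \<in> X" "X \<subseteq> {1..n}" "k \<in> Y" "Y \<subseteq> {1..n}"
    using assms by (auto simp: X_def Y_def)
  have "{1..n} - (Y \<union> X) = {n - r<..n}" using assms by (auto simp: X_def Y_def)
  then have cards: "card X = k" "card Y = m" "card ({1..n} - (Y \<union> X)) = r" "card ({1..n} - (X \<union> Y)) = r"
    using assms by (simp_all add: X_def Y_def Un_commute)
  have "M_prob p n k m r = measure_pmf.prob (dgnp n p) {D. out_cluster D k = X \<and> in_cluster D k = Y}"
    using sets cards by (intro M_prob_eq)
  also have "\<dots> = measure_pmf.prob (dgnp n p) {D. out_cluster D k = Y \<and> in_cluster D k = X}"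
    using prob_arcs_pmf_converse[of "edges_on {1..n}" "{1..n}" p
        "\<lambda>D. out_cluster D k = Y \<and> in_cluster D k = X"]
    unfolding clusters_converse dgnp_eq_arcs_pmf by (simp add: conj_commute)
  also have "\<dots> = M_prob p n m k r"
    using sets cards by (intro M_prob_eq[symmetric])
  finally show ?thesis .
qed

lemma M_prob_extend:
  assumes "0 \<le> p" "p \<le> 1" "1 \<le> k" "1 \<le> m" "k \<le> n - r" "m \<le> n - r" "n - r < k + m"
  shows "M_prob p n k m r = M_prob p (n - r) k m 0 *
    (1 - p) ^ (r * (r + k + m - n)) * (1 - p / 2) ^ (r * (2 * n - 2 * r - k - m))"
proof -
  define X where "X = {1..k}"
  define Y where "Y = {n - r - m + 1..n - r}"
  have sets: "k \<in> X" "X \<subseteq> {1..n}" "k \<in> Y" "Y \<subseteq> {1..n}"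
    using assms by (auto simp: X_def Y_def)
  have U: "X \<union> Y = {1..n - r}" and UV: "{1..n} - (X \<union> Y) = {n - r<..n}"
    using assms by (auto simp: X_def Y_def)
  have XY: "X \<inter> Y = {n - r - m + 1..k}" "X - Y = {1..n - r - m}" "Y - X = {k<..n - r}"
    using assms by (auto simp: X_def Y_def)
  have cards: "card X = k" "card Y = m" "card ({1..n} - (Y \<union> X)) = r"
    using assms UV by (simp_all add: X_def Y_def Un_commute)
  have "M_prob p n k m r = measure_pmf.prob (arcs_pmf p (edges_on {1..n}))
      {D. out_cluster D k = X \<and> in_cluster D k = Y}"
    unfolding dgnp_eq_arcs_pmf[symmetric] using sets cards by (intro M_prob_eq)
  also have "\<dots> = measure_pmf.prob (arcs_pmf p (edges_on {1..n - r}))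
      {D. out_cluster D k = X \<and> in_cluster D k = Y} *
    (1 - p) ^ (card {n - r<..n} * card (X \<inter> Y)) *
    (1 - p / 2) ^ (card {n - r<..n} * (card (X - Y) + card (Y - X)))"
    unfolding U[symmetric] UV[symmetric]
    using sets by (intro prob_clusters_restrict[OF assms(1,2)]) auto
  also have "measure_pmf.prob (arcs_pmf p (edges_on {1..n - r}))
      {D. out_cluster D k = X \<and> in_cluster D k = Y} = M_prob p (n - r) k m 0"
    unfolding dgnp_eq_arcs_pmf[symmetric] using sets cards U
    by (intro M_prob_eq[symmetric]) (auto simp: Un_commute)
  also have "card {n - r<..n} = r" using assms by simp
  also have "card (X \<inter> Y) = r + k + m - n" using assms by (simp add: XY)
  also have "card (X - Y) + card (Y - X) = 2 * n - 2 * r - k - m" using assms by (simp add: XY)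
  finally show ?thesis .
qed

text \<open>The sets \<open>{1..k}\<close> and \<open>{n - m + 1..n}\<close> serve as \<open>X\<close> and \<open>Y\<close>, the vertex \<open>k\<close> as \<open>s\<close> and \<open>n\<close> as the
  gateway. The possible sets \<open>J\<close> of the gateway decomposition are the subsets of \<open>{k<..n}\<close> containing
  \<open>n\<close>, and the summation index is the size of \<open>J\<close>. By reversal, the probability that all of \<open>J\<close>
  reaches \<open>n\<close> within \<open>J\<close> is \<open>d_prob p j j\<close>.\<close>

lemma M_prob_recursion:
  assumes "0 \<le> p" "p \<le> 1" "1 \<le> k" "1 \<le> m" "n < k + m" "k < n" "m \<le> n"
  defines "y \<equiv> 1 - p / 2" and "q \<equiv> 1 - p"
  shows "M_prob p n k m 0 =
    (\<Sum>j = 1..n - k. real ((n - k - 1) choose (j - 1)) * M_prob p (n - j) k (m - j) 0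
       * d_prob p j j * y ^ (j * (n - m))
       * (y ^ (m + k - n) - y ^ (n - k - j) * q ^ (m + k - n))
       * q ^ ((j - 1) * (m + k - n)) * y ^ ((j - 1) * (n - k - j)))"
proof -
  define V where "V = {1..n}"
  define X where "X = {1..k}"
  define Y where "Y = {n - m + 1..n}"
  let ?M = "arcs_pmf p (edges_on V)"
  let ?T = "\<lambda>D. in_cluster (D \<inter> (V - {n}) \<times> (V - {n})) k"
  let ?h = "\<lambda>j. M_prob p (n - j) k (m - j) 0 * d_prob p j j * y ^ (j * (n - m))
       * (y ^ (m + k - n) - y ^ (n - k - j) * q ^ (m + k - n))
       * q ^ ((j - 1) * (m + k - n)) * y ^ ((j - 1) * (n - k - j))"
  have sets: "k \<in> X" "X \<subseteq> V" "k \<in> Y" "Y \<subseteq> V" "X \<union> Y = V" "finite V"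
    and VX: "V - X = {k<..n}" and XY: "X \<inter> Y = {n - m + 1..k}" "X - Y = {1..n - m}"
    using assms by (auto simp: X_def Y_def V_def)
  have cXY: "card (X - Y) = n - m" "card (X \<inter> Y) = m + k - n" using assms by (simp_all add: XY)
  have n: "n \<in> V - X" using assms by (auto simp: VX)
  have alg: "M * (d * (y ^ (c * Suc i + a + i * b) * q ^ (a * i) - y ^ (c * Suc i + Suc i * b) * q ^ (a * Suc i))) =
      M * d * y ^ (Suc i * c) * (y ^ a - y ^ b * q ^ a) * q ^ (i * a) * y ^ (i * b)"
    for M d :: real and a b c i :: nat
    by (simp add: algebra_simps power_add)
  have part: "measure_pmf.prob ?M {D. (out_cluster D k = X \<and> in_cluster D k = Y) \<and> V - X - ?T D = J} =
      ?h (card J)" if J: "J \<in> {J. {n} \<subseteq> J \<and> J \<subseteq> V - X}" for J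
  proof -
    have nJ: "n \<in> J" "J \<subseteq> V - X" using J by auto
    have fJ: "finite J" using nJ(2) sets(6) finite_subset by blast
    have J0: "card J \<noteq> 0" using nJ(1) fJ by auto
    then obtain i where i: "card J = Suc i" using not0_implies_Suc by blast
    have JY: "J \<subseteq> Y" "J \<subseteq> V" using nJ(2) sets(5) by auto
    have c: "card (V - J) = n - card J" "card (Y - J) = m - card J" "card X = k"
      "card (V - X - J) = n - k - card J"
      using JY fJ nJ(2) assms by (simp_all add: card_Diff_subset VX) (simp_all add: V_def Y_def X_def)
    have inner: "V - J \<subseteq> {1..n}" "X \<subseteq> V - J" "k \<in> Y - J" "Y - J \<subseteq> V - J"
      "V - J - (Y - J \<union> X) = {}"
      using sets(1-5) nJ(2) unfolding V_def[symmetric] by blast+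
    then have M: "measure_pmf.prob (arcs_pmf p (edges_on (V - J)))
        {D. out_cluster D k = X \<and> in_cluster D k = Y - J} = M_prob p (n - card J) k (m - card J) 0"
      using M_prob_on[OF inner(1) sets(1) inner(2-4), of p] by (simp only: c inner(5) card.empty)
    have "measure_pmf.prob (arcs_pmf p (edges_on J)) {D. in_cluster D n = J} =
        measure_pmf.prob (arcs_pmf p (edges_on J)) {D. out_cluster D n = J}"
      using prob_arcs_pmf_converse[of "edges_on J" J p "\<lambda>D. out_cluster D n = J"] fJ
      by (simp add: clusters_converse)
    then have d: "measure_pmf.prob (arcs_pmf p (edges_on J)) {D. in_cluster D n = J} =
        d_prob p (card J) (card J)"
      using d_prob_on[of J n n J p] nJ(1) JY(2) by (simp add: V_def)
    have "measure_pmf.prob ?M {D. (out_cluster D k = X \<and> in_cluster D k = Y) \<and> V - X - ?T D = J} =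
      measure_pmf.prob ?M {D. out_cluster D k = X \<and> in_cluster D k = Y \<and> J = V - X - ?T D}"
      by (rule arg_cong[where f = "measure_pmf.prob _"]) auto
    also have "\<dots> = ?h (card J)"
      unfolding prob_gateway[OF assms(1,2) sets(6,1,3,5) nJ] M d cXY c(4) y_def[symmetric] q_def[symmetric]
        i diff_Suc_1
      by (rule alg)
    finally show ?thesis .
  qed
  have "n \<notin> ?T D" for D
    using assms(6) by (auto simp: in_cluster_def elim: converse_rtranclE)
  then have J_admissible: "V - X - ?T D \<in> {J. {n} \<subseteq> J \<and> J \<subseteq> V - X}" for D
    using n by auto
  have "M_prob p n k m 0 = measure_pmf.prob ?M {D. out_cluster D k = X \<and> in_cluster D k = Y}"
    using M_prob_on[of V n k X Y p] sets assms(7) by (simp add: V_def X_def Y_def Un_commute)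
  also have "\<dots> = (\<Sum>J | {n} \<subseteq> J \<and> J \<subseteq> V - X.
      measure_pmf.prob ?M {D. (out_cluster D k = X \<and> in_cluster D k = Y) \<and> V - X - ?T D = J})"
    using J_admissible sets(6) by (intro prob_partition) (auto intro: finite_subset[of _ "Pow V"])
  also have "\<dots> = (\<Sum>J | {n} \<subseteq> J \<and> J \<subseteq> V - X. ?h (card J))"
    using part by (intro sum.cong refl)
  also have "\<dots> = (\<Sum>j = 1..n - k. real ((n - k - 1) choose (j - 1)) * ?h j)"
    using sum_over_supersets[of "V - X" "{n}" ?h] n sets(6) by (simp add: VX)
  finally show ?thesis by (simp add: mult.assoc)
qed

text \<open>The event is split according to the values of both clusters; the number of vertices outside
  \<open>X \<union> Y\<close> follows from inclusion-exclusion.\<close>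

lemma prob_by_clusters:
  assumes "s \<in> {1..n}"
  shows "measure_pmf.prob (dgnp n p) {D. P (out_cluster D s) (in_cluster D s)} =
    (\<Sum>(X, Y)\<in>cluster_pairs {1..n} s. of_bool (P X Y) *
       M_prob p n (card X) (card Y) (n + card (X \<inter> Y) - card Y - card X))"
proof -
  let ?V = "{1..n}"
  have "measure_pmf.prob (dgnp n p) {D. P (out_cluster D s) (in_cluster D s)} =
      (\<Sum>XY\<in>cluster_pairs ?V s. measure_pmf.prob (dgnp n p)
        {D. P (out_cluster D s) (in_cluster D s) \<and> (out_cluster D s, in_cluster D s) = XY})"
  proof (rule prob_partition)
    fix D assume "D \<in> set_pmf (dgnp n p)"
    then have D: "D \<subseteq> ?V \<times> ?V"
      using set_arcs_pmf[OF subset_refl, of ?V D p] by (auto simp: dgnp_eq_arcs_pmf arcs_of_edges_on)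
    have "out_cluster D s \<subseteq> ?V" "in_cluster D s \<subseteq> ?V"
      using D assms by (auto simp: out_cluster_def in_cluster_def elim: rtranclE converse_rtranclE)
    then show "(out_cluster D s, in_cluster D s) \<in> cluster_pairs ?V s"
      by (simp add: cluster_pairs_def self_in_cluster)
  qed (simp add: finite_cluster_pairs)
  also have "\<dots> = (\<Sum>(X, Y)\<in>cluster_pairs ?V s. of_bool (P X Y) *
       M_prob p n (card X) (card Y) (n + card (X \<inter> Y) - card Y - card X))"
  proof (intro sum.cong refl, clarify)
    fix X Y assume "(X, Y) \<in> cluster_pairs ?V s"
    then have XY: "s \<in> X" "X \<subseteq> ?V" "s \<in> Y" "Y \<subseteq> ?V" by (auto simp: cluster_pairs_def)
    have fin: "finite X" "finite Y" using XY finite_subset by blast+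
    have "card (?V - (Y \<union> X)) = n - card (Y \<union> X)" using XY fin by (simp add: card_Diff_subset)
    then have r: "card (?V - (Y \<union> X)) = n + card (X \<inter> Y) - card Y - card X"
      using card_Un_Int[OF fin(2,1)] by (simp add: Int_commute)
    have "{D. P (out_cluster D s) (in_cluster D s) \<and> (out_cluster D s, in_cluster D s) = (X, Y)} =
        (if P X Y then {D. out_cluster D s = X \<and> in_cluster D s = Y} else {})"
      by auto
    then show "measure_pmf.prob (dgnp n p)
        {D. P (out_cluster D s) (in_cluster D s) \<and> (out_cluster D s, in_cluster D s) = (X, Y)} =
      of_bool (P X Y) * M_prob p n (card X) (card Y) (n + card (X \<inter> Y) - card Y - card X)"
      using M_prob_eq[OF XY refl refl r, of p] by simp
  qed
  finally show ?thesis .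
qed

text \<open>The probabilities of all pairs of clusters of a vertex add up to \<open>1\<close>; the pair of two full clusters
  is the summand with \<open>j = n\<close>.\<close>

lemma M_prob_total:
  assumes "1 \<le> n"
  shows "M_prob p n n n 0 = 1 - (\<Sum>j = 1..n - 1. real ((n - 1) choose (j - 1)) *
    (\<Sum>k = j..n. real ((n - j) choose (k - j)) *
      (\<Sum>m = j..n - k + j. real ((n - k) choose (m - j)) * M_prob p n k m (n + j - m - k))))"
    (is "_ = 1 - sum ?G _")
proof -
  have "1 = (\<Sum>(X, Y)\<in>cluster_pairs {1..n} 1.
      M_prob p n (card X) (card Y) (n + card (X \<inter> Y) - card Y - card X))"
    using prob_by_clusters[of 1 n p "\<lambda>_ _. True"] assms by simp
  also have "\<dots> = sum ?G {1..n}"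
    using assms by (subst sum_cluster_pairs[where n = n and f = "\<lambda>j k m. M_prob p n k m (n + j - m - k)"]) simp_all
  also have "{1..n} = insert n {1..n - 1}" using assms by auto
  also have "sum ?G \<dots> = ?G n + sum ?G {1..n - 1}" using assms by (subst sum.insert) auto
  also have "?G n = M_prob p n n n 0" by simp
  finally show ?thesis by simp
qed

lemma binomial_product_eq_multinomial4:
  assumes "1 \<le> j" "j \<le> k" "k \<le> n" "j \<le> m" "m \<le> n - k + j"
  shows "real ((n - 1) choose (j - 1)) * real ((n - j) choose (k - j)) * real ((n - k) choose (m - j)) =
    multinomial4 (n - 1) (j - 1) (m - j) (k - j) (n + j - k - m)"
proof -
  have "n - 1 - (j - 1) = n - j" "n - j - (k - j) = n - k" "n - k - (m - j) = n + j - k - m"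
    using assms by auto
  then show ?thesis
    using assms by (simp add: binomial_fact multinomial4_def)
qed

text \<open>By symmetry \<open>g_prob n p\<close> is the average, over the \<open>(n - 1) (n - 2)\<close> pairs of distinct \<open>a\<close>, \<open>b\<close> other
  than \<open>s = 1\<close>, of the probability that \<open>a\<close> lies outside the in-cluster \<open>Y\<close> and \<open>b\<close> outside the
  out-cluster \<open>X\<close>. Exchanging the sums, each pair \<open>(X, Y)\<close> is weighted by its number of such \<open>(a, b)\<close>,
  which is \<open>(n - k) (n - m) - (n + j - k - m)\<close>, the product less the pairs with \<open>a = b\<close>. This equals
  the numerator \<open>c j k m\<close>.\<close>

lemma g_prob_formula:
  assumes "3 \<le> n"
  shows "g_prob n p = (\<Sum>j = 1..n - 2. \<Sum>k = j..n - 1. \<Sum>m = j..n - k + j.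
     multinomial4 (n - 1) (j - 1) (m - j) (k - j) (n + j - k - m)
     * (((real n - real k - 1) * (real n - real m - 1) + real n - real j - 1)
         / ((real n - 1) * (real n - 2)))
     * M_prob p n k m (n + j - m - k))"
proof -
  define V where "V = {1..n}"
  define Q where "Q = (V - {1}) \<times> (V - {1}) - Id_on (V - {1})"
  define c where "c = (\<lambda>j k m. (real n - real k - 1) * (real n - real m - 1) + real n - real j - 1)"
  define M where "M = (\<lambda>j k m. M_prob p n k m (n + j - m - k))"
  define N where "N = (real n - 1) * (real n - 2)"
  have V: "finite V" "card V = n" "1 \<in> V" using assms by (auto simp: V_def)
  have card_off_diagonal: "card (A \<times> B - Id_on (A \<inter> B)) = card A * card B - card (A \<inter> B)"
    if "finite A" "finite B" for A B :: "nat set"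
  proof -
    have "Id_on (A \<inter> B) = (\<lambda>x. (x, x)) ` (A \<inter> B)" by auto
    moreover have "inj_on (\<lambda>x. (x, x)) (A \<inter> B)" by (auto simp: inj_on_def)
    ultimately have "card (Id_on (A \<inter> B)) = card (A \<inter> B)" by (simp add: card_image)
    then show ?thesis
      using that by (subst card_Diff_subset) (auto simp: card_cartesian_product Id_on_def)
  qed
  have "card Q = (n - 1) * (n - 1) - (n - 1)"
    using card_off_diagonal[of "V - {1}" "V - {1}"] V by (simp add: Q_def)
  moreover have "n = Suc (Suc (n - 2))" using assms by simp
  then obtain i where "n = Suc (Suc i)" ..
  ultimately have cQ: "real (card Q) = N" by (simp add: N_def algebra_simps)
  have finQ: "finite Q" using V by (simp add: Q_def)
  have count: "(\<Sum>ab\<in>Q. of_bool (ab \<in> S)) = real (card (Q \<inter> S))" for S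
    using finQ by simp
  have pairs: "(\<Sum>(a, b)\<in>Q. of_bool (b \<notin> X \<and> a \<notin> Y)) = c (card (X \<inter> Y)) (card X) (card Y)"
    if "(X, Y) \<in> cluster_pairs V 1" for X Y
  proof -
    have XY: "1 \<in> X" "X \<subseteq> V" "1 \<in> Y" "Y \<subseteq> V" using that by (auto simp: cluster_pairs_def)
    have fin: "finite X" "finite Y" using XY V(1) finite_subset by blast+
    let ?S = "(V - Y) \<times> (V - X) - Id_on ((V - Y) \<inter> (V - X))"
    have le: "card X \<le> n" "card Y \<le> n" "card (X \<union> Y) \<le> n"
      using XY V card_mono[of V] by auto
    have cards: "card (V - Y) = n - card Y" "card (V - X) = n - card X" "card (V - (X \<union> Y)) = n - card (X \<union> Y)"
      using XY V fin by (simp_all add: card_Diff_subset)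
    have "(V - Y) \<inter> (V - X) = V - (X \<union> Y)" by auto
    then have S: "card ?S = (n - card Y) * (n - card X) - (n - card (X \<union> Y))"
      using card_off_diagonal[of "V - Y" "V - X"] V by (simp add: cards)
    have "n - card (X \<union> Y) \<le> (n - card Y) * (n - card X)"
    proof -
      have "card (Id_on ((V - Y) \<inter> (V - X))) \<le> card ((V - Y) \<times> (V - X))"
        using V by (intro card_mono) auto
      moreover have "Id_on (V - (X \<union> Y)) = (\<lambda>x. (x, x)) ` (V - (X \<union> Y))" by auto
      moreover have "inj_on (\<lambda>x. (x, x)) (V - (X \<union> Y))" by (auto simp: inj_on_def)
      ultimately show ?thesis
        using \<open>(V - Y) \<inter> (V - X) = V - (X \<union> Y)\<close> by (simp add: card_image cards card_cartesian_product)
    qed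
    then have "real (card ?S) = (real n - real (card Y)) * (real n - real (card X)) - (real n - real (card (X \<union> Y)))"
      using le by (simp add: S of_nat_diff)
    also have "real (card (X \<union> Y)) = real (card X) + real (card Y) - real (card (X \<inter> Y))"
      using card_Un_Int[OF fin] by simp
    finally have "real (card ?S) = c (card (X \<inter> Y)) (card X) (card Y)"
      by (simp add: c_def algebra_simps)
    moreover have "(\<Sum>(a, b)\<in>Q. of_bool (b \<notin> X \<and> a \<notin> Y)) = real (card ?S)"
    proof -
      have "(\<Sum>(a, b)\<in>Q. of_bool (b \<notin> X \<and> a \<notin> Y)) = (\<Sum>ab\<in>Q. of_bool (ab \<in> ?S) :: real)"
        by (intro sum.cong refl) (auto simp: Q_def)
      also have "\<dots> = real (card (Q \<inter> ?S))" by (rule count)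
      also have "Q \<inter> ?S = ?S" using XY by (auto simp: Q_def)
      finally show ?thesis .
    qed
    ultimately show ?thesis by simp
  qed
  have g: "g_prob n p = (\<Sum>(X, Y)\<in>cluster_pairs V 1. of_bool (b \<notin> X \<and> a \<notin> Y) * M (card (X \<inter> Y)) (card X) (card Y))"
    if "(a, b) \<in> Q" for a b
  proof -
    have "g_prob n p = measure_pmf.prob (dgnp n p) {D. (a, 1) \<notin> D\<^sup>* \<and> (1, b) \<notin> D\<^sup>*}"
      using that assms by (intro g_prob_eq) (auto simp: Q_def V_def)
    also have "\<dots> = measure_pmf.prob (dgnp n p) {D. b \<notin> out_cluster D 1 \<and> a \<notin> in_cluster D 1}"
      by (simp add: out_cluster_def in_cluster_def conj_commute)
    also have "\<dots> = (\<Sum>(X, Y)\<in>cluster_pairs V 1. of_bool (b \<notin> X \<and> a \<notin> Y) * M (card (X \<inter> Y)) (card X) (card Y))"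
      using V(3) unfolding V_def M_def by (rule prob_by_clusters)
    finally show ?thesis .
  qed
  have "N * g_prob n p = (\<Sum>(a, b)\<in>Q. g_prob n p)" by (simp add: cQ split_beta)
  also have "\<dots> = (\<Sum>(a, b)\<in>Q. \<Sum>(X, Y)\<in>cluster_pairs V 1.
      of_bool (b \<notin> X \<and> a \<notin> Y) * M (card (X \<inter> Y)) (card X) (card Y))"
    using g by (intro sum.cong refl) auto
  also have "\<dots> = (\<Sum>(X, Y)\<in>cluster_pairs V 1. (\<Sum>(a, b)\<in>Q. of_bool (b \<notin> X \<and> a \<notin> Y)) *
      M (card (X \<inter> Y)) (card X) (card Y))"
    unfolding split_beta sum_distrib_right by (rule sum.swap)
  also have "\<dots> = (\<Sum>(X, Y)\<in>cluster_pairs V 1. c (card (X \<inter> Y)) (card X) (card Y) *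
      M (card (X \<inter> Y)) (card X) (card Y))"
    using pairs by (intro sum.cong refl) auto
  also have "\<dots> = (\<Sum>j = 1..n. \<Sum>k = j..n. \<Sum>m = j..n - k + j.
      multinomial4 (n - 1) (j - 1) (m - j) (k - j) (n + j - k - m) * c j k m * M j k m)"
    unfolding sum_cluster_pairs[OF V(1,3) V(2)[symmetric], where f = "\<lambda>j k m. c j k m * M j k m"]
      sum_distrib_left
    by (intro sum.cong refl, subst binomial_product_eq_multinomial4[symmetric]) auto
  \<comment> \<open>If \<open>X\<close> is everything, no \<open>b\<close> lies outside it; if \<open>j \<ge> n - 1\<close>, at most one vertex lies outside
    \<open>X \<inter> Y\<close>, which leaves no distinct \<open>a\<close> and \<open>b\<close>. These summands vanish.\<close>
  also have "\<dots> = (\<Sum>j = 1..n. \<Sum>k = j..n - 1. \<Sum>m = j..n - k + j.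
      multinomial4 (n - 1) (j - 1) (m - j) (k - j) (n + j - k - m) * c j k m * M j k m)"
  proof (intro sum.cong[OF refl] sum.mono_neutral_right[OF finite_atLeastAtMost] ballI)
    fix j k assume "j \<in> {1..n}" "k \<in> {j..n} - {j..n - 1}"
    then have "k = n" "j \<le> n" by auto
    then show "(\<Sum>m = j..n - k + j.
      multinomial4 (n - 1) (j - 1) (m - j) (k - j) (n + j - k - m) * c j k m * M j k m) = 0"
      by (simp add: c_def)
  qed auto
  also have "\<dots> = (\<Sum>j = 1..n - 2. \<Sum>k = j..n - 1. \<Sum>m = j..n - k + j.
      multinomial4 (n - 1) (j - 1) (m - j) (k - j) (n + j - k - m) * c j k m * M j k m)"
  proof (intro sum.mono_neutral_right ballI)
    fix j assume "j \<in> {1..n} - {1..n - 2}"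
    then have j: "j = n - 1 \<or> j = n" by auto
    show "(\<Sum>k = j..n - 1. \<Sum>m = j..n - k + j.
      multinomial4 (n - 1) (j - 1) (m - j) (k - j) (n + j - k - m) * c j k m * M j k m) = 0"
      using j assms by (intro sum.neutral ballI) (auto simp: c_def of_nat_diff)
  qed auto
  finally have eq: "N * g_prob n p = (\<Sum>j = 1..n - 2. \<Sum>k = j..n - 1. \<Sum>m = j..n - k + j.
      multinomial4 (n - 1) (j - 1) (m - j) (k - j) (n + j - k - m) * c j k m * M j k m)" .
  have "g_prob n p = N * g_prob n p / N" using assms by (simp add: N_def)
  then show ?thesis
    unfolding eq sum_divide_distrib by (simp add: c_def M_def N_def)
qed

theorem lemma5p3:
  fixes p y q :: real
  assumes "0 \<le> p" and "p \<le> 1" and "y = 1 - p / 2" and "q = 1 - p"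
  shows
    "(\<forall>n k m r :: nat. k \<ge> 1 \<and> m \<ge> 1 \<and> k \<le> n - r \<and> m \<le> n - r \<and> n - r < k + m \<and> r > 0 \<longrightarrow>
        M_prob p n k m r =
          M_prob p (n - r) k m 0 * q ^ (r * (r + k + m - n)) * y ^ (r * (2*n - 2*r - k - m)))
   \<and> (\<forall>n k m :: nat. k \<ge> 1 \<and> m \<ge> 1 \<and> n < k + m \<and> k < n \<and> m \<le> n \<longrightarrow>
        M_prob p n k m 0 =
          (\<Sum>j = 1..n - k. real ((n - k - 1) choose (j - 1)) * M_prob p (n - j) k (m - j) 0
             * d_prob p j j * y ^ (j * (n - m))
             * (y ^ (m + k - n) - y ^ (n - k - j) * q ^ (m + k - n))
             * q ^ ((j - 1) * (m + k - n)) * y ^ ((j - 1) * (n - k - j))))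
   \<and> (\<forall>n k m r :: nat. k \<ge> 1 \<and> m \<ge> 1 \<and> k \<le> n - r \<and> m \<le> n - r \<and> n - r < k + m \<longrightarrow>
        M_prob p n k m r = M_prob p n m k r)
   \<and> (\<forall>n :: nat. n \<ge> 1 \<longrightarrow>
        M_prob p n n n 0 =
          1 - (\<Sum>j = 1..n - 1. real ((n - 1) choose (j - 1)) *
                (\<Sum>k = j..n. real ((n - j) choose (k - j)) *
                  (\<Sum>m = j..n - k + j. real ((n - k) choose (m - j)) *
                     M_prob p n k m (n + j - m - k)))))
   \<and> (\<forall>n :: nat. n \<ge> 3 \<longrightarrow>
        g_prob n p =
          (\<Sum>j = 1..n - 2. \<Sum>k = j..n - 1. \<Sum>m = j..n - k + j.
             multinomial4 (n - 1) (j - 1) (m - j) (k - j) (n + j - k - m)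
             * (((real n - real k - 1) * (real n - real m - 1) + real n - real j - 1)
                 / ((real n - 1) * (real n - 2)))
             * M_prob p n k m (n + j - m - k)))"
  unfolding assms(3,4)
  using M_prob_extend[OF assms(1,2)] M_prob_recursion[OF assms(1,2)] M_prob_swap M_prob_total g_prob_formula
  by (intro conjI allI impI) blast+

end
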